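(* Let $\Gamma$ be a $\mathbb{Z}^d$-periodic graph. Then, for a generic labeling, the dispersion polynomial $D(z,\lambda)$ has a linear factor in $\lambda$ if and only if $\Gamma$ has a fundamental domain $W$ with a nonempty component of support $0$.
   Context: Let $d\ge 1$. A $\mathbb{Z}^d$-periodic graph is a nonempty undirected graph $\Gamma=(\mathcal V(\Gamma),\mathcal E(\Gamma))$ without self-loops $(u,u)$ and without multiple edges, with a free action of $\mathbb{Z}^d$ on the vertices, written $u\mapsto u+a$ (no nonzero $a$ fixes a vertex), preserving edges ($(u,v)\in\mathcal E(\Gamma)$ implies $(u+a,v+a)\in\mathcal E(\Gamma)$), and with finitely many orbits of vertices and of edges. A fundamental domain $W$ is a set of vertices containing exactly one vertex of each orbit; $n=|W|$ and $W$ is identified with $[n]=\{1,\dots,n\}$. A labeling $(V,E)$ of $\Gamma$ consists of a potential $V:\mathcal V(\Gamma)\to\mathbb{C}$ with $V(u+a)=V(u)$ and an edge labeling $E:\mathcal E(\Gamma)\to\mathbb{C}$ with $E((u,v))=E((v,u))=E((u+a,v+a))$ for all $a\in\mathbb{Z}^d$. $\mathbb{C}^{V,E}$ is the finite-dimensional complex affine space of all labelings; its coordinates are $v_i=V(i)$ for $i\in[n]$ and $e_{(i,j),a}=E((i,j+a))$ for the edges $(i,j+a)\in\mathcal E(\Gamma)$, subject only to the identification $e_{(i,j),a}=e_{(j,i),-a}$; put $e_{(i,j),a}=0$ if $(i,j+a)$ is not an edge. A property holds for a generic labeling if it holds on some nonempty Zariski open subset of $\mathbb{C}^{V,E}$.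 The Floquet matrix is the $n\times n$ matrix $L(z)$ with $L(z)_{i,j}=\delta_{i,j}v_i+\sum_{a\in\mathbb{Z}^d}e_{(i,j),a}z^a$, $z=(z_1,\dots,z_d)$, and the dispersion polynomial is $D(z,\lambda)=\det(L(z)-\lambda I)$ (it does not depend on the choice of fundamental domain). For a fixed labeling, $D(z,\lambda)$ has a linear factor in $\lambda$ if $\lambda-\lambda_0$ divides $D(z,\lambda)$ in $\mathbb{C}[z_1^{\pm1},\dots,z_d^{\pm1},\lambda]$ for some $\lambda_0\in\mathbb{C}$. For a fundamental domain $W$, a subset $U\subseteq W$ is a component of $W$ if there are no $u\in U$, $v\in W\setminus U$, $a\in\mathbb{Z}^d$ with $(u,v+a)\in\mathcal E(\Gamma)$. The support of $U\subseteq W$ is $\mathcal A(U)=\{a\in\mathbb{Z}^d : \exists\, u,v\in U,\ (u,v+a)\in\mathcal E(\Gamma)\}$, and $U$ has support $0$ if $\mathcal A(U)=\emptyset$ or $\mathcal A(U)=\{(0,\dots,0)\}$. *)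

theory Defs
  imports
    "HOL-Analysis.Finite_Cartesian_Product"
    "HOL-Library.Poly_Mapping"
    "Jordan_Normal_Form.Determinant"
begin

(* The dimension d is CARD('d), so d >= 1 holds for every instance of 'd. Edges are stored as a
   symmetric relation, and act G u a is the translate u + a. *)
record ('v, 'd) zgraph =
  verts :: "'v set"
  edges :: "('v \<times> 'v) set"
  act :: "'v \<Rightarrow> int ^ 'd \<Rightarrow> 'v"

definition vertex_orbit :: "('v, 'd::finite) zgraph \<Rightarrow> 'v \<Rightarrow> 'v set" where
  "vertex_orbit G u = {act G u a | a. True}"

definition edge_orbit :: "('v, 'd::finite) zgraph \<Rightarrow> 'v \<times> 'v \<Rightarrow> ('v \<times> 'v) set" where
  "edge_orbit G e = {(act G (fst e) a, act G (snd e) a) | a. True}"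

locale periodic_graph =
  fixes G :: "('v, 'd::finite) zgraph"
  assumes verts_nonempty: "verts G \<noteq> {}"
    and edges_subset: "edges G \<subseteq> verts G \<times> verts G"
    and edges_sym: "sym (edges G)"
    and edges_irrefl: "irrefl (edges G)"
    and act_closed: "\<And>u a. u \<in> verts G \<Longrightarrow> act G u a \<in> verts G"
    and act_zero: "\<And>u. u \<in> verts G \<Longrightarrow> act G u 0 = u"
    and act_add: "\<And>u a b. u \<in> verts G \<Longrightarrow> act G u (a + b) = act G (act G u a) b"
    and act_free: "\<And>u a. u \<in> verts G \<Longrightarrow> act G u a = u \<Longrightarrow> a = 0"
    and act_edges: "\<And>u v a. (u, v) \<in> edges G \<Longrightarrow> (act G u a, act G v a) \<in> edges G"
    and finite_vertex_orbits: "finite (vertex_orbit G ` verts G)"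
    and finite_edge_orbits: "finite (edge_orbit G ` edges G)"

definition fundamental_domain :: "('v, 'd::finite) zgraph \<Rightarrow> 'v set \<Rightarrow> bool" where
  "fundamental_domain G W \<longleftrightarrow>
     W \<subseteq> verts G \<and> (\<forall>u \<in> verts G. \<exists>!w. w \<in> W \<and> w \<in> vertex_orbit G u)"

definition is_component :: "('v, 'd::finite) zgraph \<Rightarrow> 'v set \<Rightarrow> 'v set \<Rightarrow> bool" where
  "is_component G W U \<longleftrightarrow>
     U \<subseteq> W \<and> \<not> (\<exists>u \<in> U. \<exists>v \<in> W - U. \<exists>a. (u, act G v a) \<in> edges G)"

definition support :: "('v, 'd::finite) zgraph \<Rightarrow> 'v set \<Rightarrow> (int ^ 'd) set" where
  "support G U = {a. \<exists>u \<in> U. \<exists>v \<in> U. (u, act G v a) \<in> edges G}"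

definition has_support_zero :: "('v, 'd::finite) zgraph \<Rightarrow> 'v set \<Rightarrow> bool" where
  "has_support_zero G U \<longleftrightarrow> support G U = {} \<or> support G U = {0}"

type_synonym 'v labeling = "('v \<Rightarrow> complex) \<times> ('v \<times> 'v \<Rightarrow> complex)"

(* Labels are normalised to 0 off the vertices and edges, so that distinct elements of this set are
   distinct labelings and E (i, j + a) is the coordinate of the pair (i, j) at a, with its
   convention that non-edges contribute 0. *)
definition labelings :: "('v, 'd::finite) zgraph \<Rightarrow> 'v labeling set" where
  "labelings G = {(V, E).
     (\<forall>u \<in> verts G. \<forall>a. V (act G u a) = V u) \<and>
     (\<forall>(u, v) \<in> edges G. E (u, v) = E (v, u) \<and> (\<forall>a. E (act G u a, act G v a) = E (u, v))) \<and>
     (\<forall>u. u \<notin> verts G \<longrightarrow> V u = 0) \<and>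
     (\<forall>e. e \<notin> edges G \<longrightarrow> E e = 0)}"

(* Every coordinate of the labeling space is evaluation at a vertex or at an edge; evaluations at
   two points of one orbit agree on labelings G. *)
inductive_set polynomial_functions :: "('v, 'd::finite) zgraph \<Rightarrow> ('v labeling \<Rightarrow> complex) set"
  for G where
  const: "(\<lambda>_. c) \<in> polynomial_functions G"
| vertex: "u \<in> verts G \<Longrightarrow> (\<lambda>l. fst l u) \<in> polynomial_functions G"
| edge: "e \<in> edges G \<Longrightarrow> (\<lambda>l. snd l e) \<in> polynomial_functions G"
| add: "\<lbrakk>p \<in> polynomial_functions G; q \<in> polynomial_functions G\<rbrakk>
    \<Longrightarrow> (\<lambda>l. p l + q l) \<in> polynomial_functions G"
| mult: "\<lbrakk>p \<in> polynomial_functions G; q \<in> polynomial_functions G\<rbrakk>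
    \<Longrightarrow> (\<lambda>l. p l * q l) \<in> polynomial_functions G"

definition zariski_closed :: "('v, 'd::finite) zgraph \<Rightarrow> 'v labeling set \<Rightarrow> bool" where
  "zariski_closed G Z \<longleftrightarrow>
     (\<exists>F \<subseteq> polynomial_functions G. Z = {l \<in> labelings G. \<forall>f \<in> F. f l = 0})"

definition zariski_open :: "('v, 'd::finite) zgraph \<Rightarrow> 'v labeling set \<Rightarrow> bool" where
  "zariski_open G O' \<longleftrightarrow> O' \<subseteq> labelings G \<and> zariski_closed G (labelings G - O')"

definition for_generic_labeling ::
  "('v, 'd::finite) zgraph \<Rightarrow> ('v labeling \<Rightarrow> bool) \<Rightarrow> bool" where
  "for_generic_labeling G P \<longleftrightarrow> (\<exists>O'. zariski_open G O' \<and> O' \<noteq> {} \<and> (\<forall>l \<in> O'. P l))"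

(* Laurent polynomials in z are the group algebra of the exponent lattice: the product on
   poly_mapping is convolution, and z^a is Poly_Mapping.single a 1. *)
type_synonym 'd laurent = "(int ^ 'd) \<Rightarrow>\<^sub>0 complex"

(* The list ws identifies a fundamental domain with {0, ..., n - 1}. The sum over a runs over the
   edges only, which is a finite index set in a periodic graph; all other coefficients are 0. *)
definition floquet_matrix ::
  "('v, 'd::finite) zgraph \<Rightarrow> 'v list \<Rightarrow> 'v labeling \<Rightarrow> 'd laurent mat" where
  "floquet_matrix G ws l = mat (length ws) (length ws) (\<lambda>(i, j).
     (if i = j then Poly_Mapping.single 0 (fst l (ws ! i)) else 0) +
     (\<Sum>a \<in> {a. (ws ! i, act G (ws ! j) a) \<in> edges G}.
        Poly_Mapping.single a (snd l (ws ! i, act G (ws ! j) a))))"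

(* The poly variable [:0, 1:] is lambda. *)
definition dispersion_polynomial ::
  "('v, 'd::finite) zgraph \<Rightarrow> 'v list \<Rightarrow> 'v labeling \<Rightarrow> 'd laurent poly" where
  "dispersion_polynomial G ws l =
     det (map_mat (\<lambda>c. [:c:]) (floquet_matrix G ws l) - [:0, 1:] \<cdot>\<^sub>m 1\<^sub>m (length ws))"

definition has_linear_factor :: "'d::finite laurent poly \<Rightarrow> bool" where
  "has_linear_factor D \<longleftrightarrow> (\<exists>c :: complex. [:- Poly_Mapping.single 0 c, 1:] dvd D)"

end

theory Submission
  imports Defs "Jordan_Normal_Form.Char_Poly" "HOL-Computational_Algebra.Field_as_Ring"
begin

text \<open>
  If a component U of support 0 exists, then after moving the vertices into U by translations the
  corresponding block of the Floquet matrix is constant, and an eigenvector of this block extends by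
  zero to a kernel vector of L(z) - \<mu>.

  Otherwise it suffices to find one labeling and two points z, w for which L(z) and L(w) have no common
  eigenvalue, since the resultant of the two characteristic polynomials is a polynomial in the labels.
  On each connected component of the quotient graph, choose lifts along a spanning tree. Adding the
  leaves one at a time with label 1 and suitable potentials gives a symmetric matrix A on the tree none
  of whose eigenvectors has a zero entry. As the support of the component is not 0, there is an edge
  (u, v + a) with a \<noteq> 0; label it \<epsilon> and put s = z^a. No eigenvalue of A is a zero of the (u, v) cofactor
  of A - \<mu>, so for a suitable \<epsilon> each \<mu> is an eigenvalue of the block for only finitely many s. Taking z = 1
  and w = (t^m_1, ..., t^m_d) with m not orthogonal to any of the vectors a, all but finitely many t avoid
  the eigenvalues of L(1).
\<close>

section \<open>Singular matrices indexed by finite sets\<close>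

text \<open>Stated through a kernel vector on a bare set, so that no ordering has to be chosen and
  vectors can be restricted to components. Determinants enter by listing the set.\<close>

definition singular_on :: "'i set \<Rightarrow> ('i \<Rightarrow> 'i \<Rightarrow> complex) \<Rightarrow> bool" where
  "singular_on S M \<longleftrightarrow> (\<exists>x. (\<exists>i\<in>S. x i \<noteq> 0) \<and> (\<forall>i\<in>S. (\<Sum>j\<in>S. M i j * x j) = 0))"

definition shift_diag :: "('i \<Rightarrow> 'i \<Rightarrow> complex) \<Rightarrow> complex \<Rightarrow> 'i \<Rightarrow> 'i \<Rightarrow> complex" where
  "shift_diag M \<mu> i j = M i j - (if i = j then \<mu> else 0)"

definition list_mat :: "'i list \<Rightarrow> ('i \<Rightarrow> 'i \<Rightarrow> 'a) \<Rightarrow> 'a mat" where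
  "list_mat es M = mat (length es) (length es) (\<lambda>(i, j). M (es ! i) (es ! j))"

lemma list_mat_carrier [simp]: "list_mat es M \<in> carrier_mat (length es) (length es)"
  by (simp add: list_mat_def)

lemma sum_list_index:
  assumes "distinct es"
  shows "(\<Sum>j = 0..<length es. f (es ! j)) = sum f (set es)"
proof -
  have "bij_betw ((!) es) {0..<length es} (set es)"
    by (rule bij_betw_nth[OF assms]) auto
  from sum.reindex_bij_betw[OF this] show ?thesis .
qed

lemma singular_on_iff_det:
  assumes "distinct es"
  shows "singular_on (set es) M \<longleftrightarrow> det (list_mat es M) = 0"
proof -
  let ?n = "length es"
  have row: "(list_mat es M *\<^sub>v v) $ i = (\<Sum>j = 0..<?n. M (es ! i) (es ! j) * v $ j)"
    if "i < ?n" "v \<in> carrier_vec ?n" for v i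
    using that by (simp add: list_mat_def scalar_prod_def)
  show ?thesis
    unfolding det_0_iff_vec_prod_zero[OF list_mat_carrier]
  proof
    assume "singular_on (set es) M"
    then obtain x where x: "\<exists>i\<in>set es. x i \<noteq> 0" "\<forall>i\<in>set es. (\<Sum>j\<in>set es. M i j * x j) = 0"
      unfolding singular_on_def by blast
    let ?v = "vec ?n (\<lambda>i. x (es ! i))"
    have "(list_mat es M *\<^sub>v ?v) $ i = 0" if "i < ?n" for i
    proof -
      have "(list_mat es M *\<^sub>v ?v) $ i = (\<Sum>j = 0..<?n. M (es ! i) (es ! j) * x (es ! j))"
        using row[OF that, of ?v] by simp
      also have "\<dots> = (\<Sum>j\<in>set es. M (es ! i) j * x j)"
        by (rule sum_list_index[OF assms])
      finally show ?thesis using x(2) that by auto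
    qed
    hence "list_mat es M *\<^sub>v ?v = 0\<^sub>v ?n"
      by (intro eq_vecI) (auto simp: list_mat_def)
    moreover obtain i where i: "i < ?n" "x (es ! i) \<noteq> 0"
      using x(1) by (metis in_set_conv_nth)
    hence "?v $ i \<noteq> 0\<^sub>v ?n $ i" by simp
    hence "?v \<noteq> 0\<^sub>v ?n" by metis
    ultimately show "\<exists>v. v \<in> carrier_vec ?n \<and> v \<noteq> 0\<^sub>v ?n \<and> list_mat es M *\<^sub>v v = 0\<^sub>v ?n"
      by (intro exI[of _ ?v]) auto
  next
    assume "\<exists>v. v \<in> carrier_vec ?n \<and> v \<noteq> 0\<^sub>v ?n \<and> list_mat es M *\<^sub>v v = 0\<^sub>v ?n"
    then obtain v where v: "v \<in> carrier_vec ?n" "v \<noteq> 0\<^sub>v ?n" "list_mat es M *\<^sub>v v = 0\<^sub>v ?n"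
      by blast
    \<comment> \<open>Inverting the enumeration turns the vector \<open>v\<close> into a function on
      the index set.\<close>
    define x where "x i = v $ (the_inv_into {0..<?n} ((!) es) i)" for i
    have inj: "inj_on ((!) es) {0..<?n}"
      using assms by (auto simp: inj_on_def nth_eq_iff_index_eq)
    have x: "x (es ! i) = v $ i" if "i < ?n" for i
      using the_inv_into_f_f[OF inj, of i] that by (simp add: x_def)
    show "singular_on (set es) M"
      unfolding singular_on_def
    proof (intro exI conjI ballI)
      obtain i where "i < ?n" "v $ i \<noteq> 0"
        using v(1,2) by (metis carrier_vecD eq_vecI index_zero_vec(1,2))
      thus "\<exists>i\<in>set es. x i \<noteq> 0" using x by (metis nth_mem)
    next
      fix i assume "i \<in> set es"
      then obtain k where k: "k < ?n" "i = es ! k" by (metis in_set_conv_nth)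
      have "(\<Sum>j\<in>set es. M i j * x j) = (\<Sum>j = 0..<?n. M i (es ! j) * x (es ! j))"
        by (rule sum_list_index[OF assms, symmetric])
      also have "\<dots> = (\<Sum>j = 0..<?n. M (es ! k) (es ! j) * v $ j)"
        by (intro sum.cong) (auto simp: x k)
      also have "\<dots> = (list_mat es M *\<^sub>v v) $ k" using row[OF k(1) v(1)] by simp
      finally show "(\<Sum>j\<in>set es. M i j * x j) = 0" using v(3) k by simp
    qed
  qed
qed

lemma eval_poly_hom: "comm_ring_hom (\<lambda>p. poly p (c :: 'a :: comm_ring_1))"
  by unfold_locales auto

text \<open>The determinant is a polynomial in the parameter; being nonzero at \<open>s0\<close>, it
  has only finitely many roots.\<close>

lemma finite_singular_parameters:
  fixes P :: "'i \<Rightarrow> 'i \<Rightarrow> complex poly"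
  assumes "finite S" and ns: "\<not> singular_on S (\<lambda>i j. poly (P i j) s0)"
  shows "finite {s. singular_on S (\<lambda>i j. poly (P i j) s)}"
proof -
  obtain es where es: "set es = S" "distinct es"
    using finite_distinct_list[OF assms(1)] by blast
  have eq: "singular_on S (\<lambda>i j. poly (P i j) s) \<longleftrightarrow> poly (det (list_mat es P)) s = 0" for s
  proof -
    have "list_mat es (\<lambda>i j. poly (P i j) s) = map_mat (\<lambda>p. poly p s) (list_mat es P)"
      by (intro eq_matI) (auto simp: list_mat_def)
    hence "det (list_mat es (\<lambda>i j. poly (P i j) s)) = poly (det (list_mat es P)) s"
      using comm_ring_hom.hom_det[OF eval_poly_hom, of s "list_mat es P"] by argo
    thus ?thesis
      unfolding es(1)[symmetric] singular_on_iff_det[OF es(2)] by argo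
  qed
  hence "det (list_mat es P) \<noteq> 0" using ns by force
  thus ?thesis unfolding eq by (rule poly_roots_finite)
qed

lemma singular_shift_iff_char_poly:
  assumes "distinct es"
  shows "singular_on (set es) (shift_diag M \<mu>) \<longleftrightarrow> poly (char_poly (list_mat es M)) \<mu> = 0"
proof -
  have "list_mat es (shift_diag M \<mu>) = char_matrix (list_mat es M) \<mu>"
    unfolding char_matrix_def
    by (intro eq_matI) (auto simp: list_mat_def shift_diag_def nth_eq_iff_index_eq[OF assms])
  thus ?thesis
    using singular_on_iff_det[OF assms, of "shift_diag M \<mu>"]
      eigenvalue_det[OF list_mat_carrier] eigenvalue_root_char_poly[OF list_mat_carrier]
    by metis
qed

text \<open>A complex characteristic polynomial of positive degree has a root.\<close>

lemma eigenvalue_exists: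
  assumes "finite S" "S \<noteq> {}"
  obtains \<mu> where "singular_on S (shift_diag M \<mu>)"
proof -
  obtain es where es: "set es = S" "distinct es"
    using finite_distinct_list[OF assms(1)] by blast
  have "degree (char_poly (list_mat es M)) = length es"
    using degree_monic_char_poly[OF list_mat_carrier] by blast
  hence "degree (char_poly (list_mat es M)) \<noteq> 0" using es assms(2) by auto
  hence "\<not> constant (poly (char_poly (list_mat es M)))" by (simp add: constant_degree)
  then obtain \<mu> where "poly (char_poly (list_mat es M)) \<mu> = 0"
    using fundamental_theorem_of_algebra by blast
  thus ?thesis using singular_shift_iff_char_poly[OF es(2)] es(1) that by metis
qed

section \<open>Matrices without vanishing eigenvector entries\<close>

definition full_eigenvectors :: "'i set \<Rightarrow> ('i \<Rightarrow> 'i \<Rightarrow> complex) \<Rightarrow> bool" where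
  "full_eigenvectors S A \<longleftrightarrow>
     (\<forall>\<mu> x. (\<forall>i\<in>S. (\<Sum>j\<in>S. shift_diag A \<mu> i j * x j) = 0) \<longrightarrow> (\<exists>i\<in>S. x i \<noteq> 0) \<longrightarrow> (\<forall>i\<in>S. x i \<noteq> 0))"

text \<open>Symmetry under transposition, without conjugation: an edge and its reversal carry the
  same complex label.\<close>

definition symmetric_on :: "'i set \<Rightarrow> ('i \<Rightarrow> 'i \<Rightarrow> complex) \<Rightarrow> bool" where
  "symmetric_on S A \<longleftrightarrow> (\<forall>i\<in>S. \<forall>j\<in>S. A i j = A j i)"

text \<open>For \<open>u\<close> and \<open>v\<close> in the index set, the determinant of this
  matrix is the (\<open>u\<close>, \<open>v\<close>) cofactor of \<open>M\<close>, so its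
  singularity is the vanishing of that cofactor.\<close>

definition unit_row :: "'i \<Rightarrow> 'i \<Rightarrow> ('i \<Rightarrow> 'i \<Rightarrow> complex) \<Rightarrow> 'i \<Rightarrow> 'i \<Rightarrow> complex" where
  "unit_row u v M i j = (if i = u then (if j = v then 1 else 0) else M i j)"

text \<open>The bilinear identity y^T (A - \<mu>) x = ((A - \<mu>) y)^T x.\<close>

lemma symmetric_sum_swap:
  assumes "symmetric_on S A"
  shows "(\<Sum>i\<in>S. y i * (\<Sum>j\<in>S. shift_diag A \<mu> i j * x j)) =
         (\<Sum>i\<in>S. (\<Sum>j\<in>S. shift_diag A \<mu> i j * y j) * x i)"
proof -
  have "(\<Sum>i\<in>S. y i * (\<Sum>j\<in>S. shift_diag A \<mu> i j * x j)) =
        (\<Sum>i\<in>S. \<Sum>j\<in>S. y i * (shift_diag A \<mu> i j * x j))"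
    by (simp add: sum_distrib_left)
  also have "\<dots> = (\<Sum>j\<in>S. \<Sum>i\<in>S. y i * (shift_diag A \<mu> i j * x j))" by (rule sum.swap)
  also have "\<dots> = (\<Sum>j\<in>S. \<Sum>i\<in>S. shift_diag A \<mu> j i * y i * x j)"
    using assms by (intro sum.cong) (auto simp: symmetric_on_def shift_diag_def)
  finally show ?thesis by (simp add: sum_distrib_right)
qed

(* Pairing with an eigenvector y, which does not vanish at u. *)
lemma full_eigenvectors_range:
  assumes "finite S" "symmetric_on S A" "full_eigenvectors S A" "u \<in> S"
    and sing: "singular_on S (shift_diag A \<mu>)"
    and x: "\<And>i. i \<in> S \<Longrightarrow> i \<noteq> u \<Longrightarrow> (\<Sum>j\<in>S. shift_diag A \<mu> i j * x j) = 0"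
  shows "(\<Sum>j\<in>S. shift_diag A \<mu> u j * x j) = 0"
proof -
  obtain y where y: "\<exists>i\<in>S. y i \<noteq> 0" "\<forall>i\<in>S. (\<Sum>j\<in>S. shift_diag A \<mu> i j * y j) = 0"
    using sing unfolding singular_on_def by blast
  have yu: "y u \<noteq> 0" using assms(3,4) y unfolding full_eigenvectors_def by blast
  have "(\<Sum>i\<in>S. y i * (\<Sum>j\<in>S. shift_diag A \<mu> i j * x j)) = 0"
    unfolding symmetric_sum_swap[OF assms(2)] using y(2) by simp
  moreover have "(\<Sum>i\<in>S. y i * (\<Sum>j\<in>S. shift_diag A \<mu> i j * x j)) =
      y u * (\<Sum>j\<in>S. shift_diag A \<mu> u j * x j)"
    using assms(1,4) x by (subst sum.remove[of _ u]) auto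
  ultimately show ?thesis using yu by simp
qed

text \<open>A kernel vector of the modified matrix vanishes at \<open>v\<close> and satisfies every
  row of A - \<mu> except row \<open>u\<close>. If \<mu> were an eigenvalue,
  \<open>full_eigenvectors_range\<close> would supply row \<open>u\<close> as well, giving an
  eigenvector with a zero entry.\<close>

lemma unit_row_singular_imp:
  assumes "finite S" "symmetric_on S A" "full_eigenvectors S A" "u \<in> S" "v \<in> S"
    and "singular_on S (unit_row u v (shift_diag A \<mu>))"
  shows "\<not> singular_on S (shift_diag A \<mu>)"
proof
  assume sing: "singular_on S (shift_diag A \<mu>)"
  obtain x where x: "\<exists>i\<in>S. x i \<noteq> 0"
    "\<forall>i\<in>S. (\<Sum>j\<in>S. unit_row u v (shift_diag A \<mu>) i j * x j) = 0"
    using assms(6) unfolding singular_on_def by blast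
  have "(\<Sum>j\<in>S. (if j = v then 1 else 0) * x j) = 0"
    using x(2) assms(4) by (auto simp: unit_row_def)
  moreover have "(\<Sum>j\<in>S. (if j = v then 1 else 0) * x j) = x v"
    using assms(1,5) by (simp add: if_distrib[of "\<lambda>c. c * _"] cong: if_cong)
  ultimately have xv: "x v = 0" by simp
  have rows: "(\<Sum>j\<in>S. shift_diag A \<mu> i j * x j) = 0" if "i \<in> S" "i \<noteq> u" for i
    using bspec[OF x(2) that(1)] that(2) by (simp add: unit_row_def)
  from full_eigenvectors_range[OF assms(1-4) sing rows] rows
  have "\<forall>i\<in>S. (\<Sum>j\<in>S. shift_diag A \<mu> i j * x j) = 0" by metis
  with assms(3,5) x(1) xv show False unfolding full_eigenvectors_def by blast
qed

text \<open>The cofactor is a polynomial in \<mu> and does not vanish at an eigenvalue of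
  \<open>A\<close>, of which there is at least one.\<close>

lemma finite_unit_row_singular:
  assumes "finite S" "symmetric_on S A" "full_eigenvectors S A" "u \<in> S" "v \<in> S"
  shows "finite {\<mu>. singular_on S (unit_row u v (shift_diag A \<mu>))}"
proof -
  let ?P = "\<lambda>i j. if i = u then (if j = v then 1 else 0)
    else [:A i j:] - (if i = j then [:0, 1:] else 0)"
  have eq: "unit_row u v (shift_diag A \<mu>) = (\<lambda>i j. poly (?P i j) \<mu>)" for \<mu>
    by (auto simp: unit_row_def shift_diag_def fun_eq_iff)
  obtain \<mu>0 where "singular_on S (shift_diag A \<mu>0)"
    using eigenvalue_exists[of S A] assms(1,4) by auto
  with unit_row_singular_imp[OF assms] have "\<not> singular_on S (unit_row u v (shift_diag A \<mu>0))"
    by blast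
  thus ?thesis unfolding eq by (rule finite_singular_parameters[OF assms(1)])
qed

lemma full_eigenvectors_singleton: "full_eigenvectors {r} A"
  by (auto simp: full_eigenvectors_def)

section \<open>Growing a tree by one leaf\<close>

definition add_leaf :: "'i set \<Rightarrow> ('i \<Rightarrow> 'i \<Rightarrow> complex) \<Rightarrow> 'i \<Rightarrow> 'i \<Rightarrow> complex \<Rightarrow> 'i \<Rightarrow> 'i \<Rightarrow> complex" where
  "add_leaf S A u w c i j =
     (if i \<in> S \<and> j \<in> S then A i j
      else if i = w \<and> j = w then c
      else if i = u \<and> j = w \<or> i = w \<and> j = u then 1 else 0)"

(* Let (x, \<tau>) be an eigenvector for \<mu> with \<tau> at the new leaf w. If \<tau> = 0 then x is an eigenvector of
   A vanishing at u. Otherwise, scaling \<tau> to 1, (A - \<mu>) x = -e_u and x u = \<mu> - c; a zero of x confines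
   \<mu> to a finite set of non-eigenvalues, each of which determines x and hence c. *)
lemma full_eigenvectors_add_leaf:
  assumes fin: "finite S" and sym: "symmetric_on S A" and full: "full_eigenvectors S A"
    and u: "u \<in> S" and w: "w \<notin> S"
  shows "\<exists>c. full_eigenvectors (insert w S) (add_leaf S A u w c)"
proof -
  \<comment> \<open>The exceptional \<mu>: those at which some (\<open>u\<close>, \<open>i\<close>)
    cofactor of A - \<mu> vanishes.\<close>
  define Z where "Z = (\<Union>i\<in>S. {\<mu>. singular_on S (unit_row u i (shift_diag A \<mu>))})"
  have "finite Z"
    unfolding Z_def using fin finite_unit_row_singular[OF fin sym full u] by blast
  define sol where "sol \<mu> x \<longleftrightarrow>
    (\<forall>i\<in>S. (\<Sum>j\<in>S. shift_diag A \<mu> i j * x j) = (if i = u then -1 else 0))" for \<mu> x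
  \<comment> \<open>An arbitrary solution, if there is one. For \<mu> in \<open>Z\<close> the choice
    does not matter at \<open>u\<close>, because such \<mu> are not eigenvalues of
    \<open>A\<close>.\<close>
  define X where "X \<mu> = (SOME x. sol \<mu> x)" for \<mu>
  have unique: "x u = X \<mu> u" if "\<mu> \<in> Z" "sol \<mu> x" for \<mu> x
  proof (rule ccontr)
    assume ne: "x u \<noteq> X \<mu> u"
    have "sol \<mu> (X \<mu>)" unfolding X_def by (rule someI[of "sol \<mu>", OF that(2)])
    hence "\<forall>i\<in>S. (\<Sum>j\<in>S. shift_diag A \<mu> i j * (x j - X \<mu> j)) = 0"
      using that(2) by (simp add: sol_def algebra_simps sum_subtractf)
    hence "singular_on S (shift_diag A \<mu>)"
      unfolding singular_on_def using ne u by (intro exI[of _ "\<lambda>j. x j - X \<mu> j"]) auto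
    thus False using that(1) unit_row_singular_imp[OF fin sym full u] by (auto simp: Z_def)
  qed
  have "finite ((\<lambda>\<mu>. \<mu> - X \<mu> u) ` Z)" using \<open>finite Z\<close> by simp
  \<comment> \<open>The new potential \<open>c\<close> avoids every value that a zero entry could
    force through x u = \<mu> - c.\<close>
  then obtain c where c: "c \<notin> (\<lambda>\<mu>. \<mu> - X \<mu> u) ` Z"
    using ex_new_if_finite[OF infinite_UNIV_char_0] by blast
  have "full_eigenvectors (insert w S) (add_leaf S A u w c)"
    unfolding full_eigenvectors_def
  proof (intro allI impI)
    fix \<mu> z
    assume z: "\<forall>i\<in>insert w S. (\<Sum>j\<in>insert w S. shift_diag (add_leaf S A u w c) \<mu> i j * z j) = 0"
      and nz: "\<exists>i\<in>insert w S. z i \<noteq> 0"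
    have rowS: "(\<Sum>j\<in>S. shift_diag A \<mu> i j * z j) = (if i = u then - z w else 0)" if "i \<in> S" for i
    proof -
      have "i \<noteq> w" using that w by blast
      have "(\<Sum>j\<in>S. shift_diag (add_leaf S A u w c) \<mu> i j * z j) = (\<Sum>j\<in>S. shift_diag A \<mu> i j * z j)"
        using that by (intro sum.cong) (auto simp: shift_diag_def add_leaf_def)
      moreover have "shift_diag (add_leaf S A u w c) \<mu> i w = (if i = u then 1 else 0)"
        using that w \<open>i \<noteq> w\<close> by (auto simp: shift_diag_def add_leaf_def)
      ultimately show ?thesis
        using bspec[OF z, of i] that fin w
        by (auto simp: eq_neg_iff_add_eq_0 add.commute split: if_splits)
    qed
    have roww: "z u + (c - \<mu>) * z w = 0"
    proof -
      have "(\<Sum>j\<in>S. shift_diag (add_leaf S A u w c) \<mu> w j * z j) = (\<Sum>j\<in>S. (if j = u then z j else 0))"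
        using w by (intro sum.cong) (auto simp: shift_diag_def add_leaf_def)
      also have "\<dots> = z u" using fin u by simp
      finally show ?thesis
        using bspec[OF z, of w] fin w by (simp add: shift_diag_def add_leaf_def add.commute)
    qed
    have zw: "z w \<noteq> 0"
    proof
      assume 0: "z w = 0"
      hence "\<forall>i\<in>S. (\<Sum>j\<in>S. shift_diag A \<mu> i j * z j) = 0" using rowS by simp
      moreover have "\<exists>i\<in>S. z i \<noteq> 0" using nz 0 by blast
      ultimately have "z u \<noteq> 0" using full u unfolding full_eigenvectors_def by blast
      thus False using roww 0 by simp
    qed
    have "z i \<noteq> 0" if i: "i \<in> S" for i
    proof
      assume 0: "z i = 0"
      have "\<exists>i\<in>S. z i \<noteq> 0"
      proof (rule ccontr)
        assume "\<not> ?thesis"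
        hence "(\<Sum>j\<in>S. shift_diag A \<mu> u j * z j) = 0" by (intro sum.neutral) auto
        thus False using rowS[OF u] zw by simp
      qed
      \<comment> \<open>Row \<open>u\<close> of the modified matrix only asks for
        \<open>z i = 0\<close>, and the other rows hold by \<open>rowS\<close>; hence \<mu> lies in
        \<open>Z\<close>.\<close>
      moreover have "\<forall>k\<in>S. (\<Sum>j\<in>S. unit_row u i (shift_diag A \<mu>) k j * z j) = 0"
      proof
        fix k assume k: "k \<in> S"
        show "(\<Sum>j\<in>S. unit_row u i (shift_diag A \<mu>) k j * z j) = 0"
        proof (cases "k = u")
          case True
          thus ?thesis using 0 by (intro sum.neutral) (auto simp: unit_row_def)
        next
          case False
          thus ?thesis using rowS[OF k] by (simp add: unit_row_def)
        qed
      qed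
      ultimately have "\<mu> \<in> Z" unfolding Z_def singular_on_def using i by blast
      moreover have "sol \<mu> (\<lambda>j. z j / z w)"
        using rowS zw by (auto simp: sol_def simp flip: sum_divide_distrib)
      ultimately have "z u / z w = X \<mu> u" using unique by blast
      moreover have "z u / z w = \<mu> - c" using roww zw by (simp add: field_simps eq_neg_iff_add_eq_0)
      ultimately have "c = \<mu> - X \<mu> u" by (simp add: algebra_simps)
      with \<open>\<mu> \<in> Z\<close> c show False by blast
    qed
    with zw show "\<forall>i\<in>insert w S. z i \<noteq> 0" by blast
  qed
  thus ?thesis ..
qed

text \<open>Contribution of the edge (u, v + a) and of its reversal, with s = z^a. The sum form
  covers u = v, where s + 1/s stands on the diagonal.\<close>

definition loop_term :: "'i \<Rightarrow> 'i \<Rightarrow> complex \<Rightarrow> 'i \<Rightarrow> 'i \<Rightarrow> complex" where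
  "loop_term u v s i j = (if i = u \<and> j = v then s else 0) + (if i = v \<and> j = u then inverse s else 0)"

(* Row v is scaled by s so that all entries become polynomials in s; at s = 0 that row is \<epsilon> e_u.
   For the finitely many \<mu> where this specialisation is singular, s = 1 is used instead. *)
lemma finite_singular_loop:
  assumes fin: "finite S" and sym: "symmetric_on S A" and full: "full_eigenvectors S A"
    and u: "u \<in> S" and v: "v \<in> S"
  shows "\<exists>\<epsilon>. \<forall>\<mu>. finite {s. s \<noteq> 0 \<and>
    singular_on S (shift_diag (\<lambda>i j. A i j + \<epsilon> * loop_term u v s i j) \<mu>)}"
proof -
  define Z where "Z = {\<mu>. singular_on S (unit_row v u (shift_diag A \<mu>))}"
  have "finite Z" unfolding Z_def by (rule finite_unit_row_singular[OF fin sym full v u])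
  define B where "B \<mu> = {\<epsilon>. singular_on S (shift_diag (\<lambda>i j. A i j + \<epsilon> * loop_term u v 1 i j) \<mu>)}" for \<mu>
  have "finite (B \<mu>)" if "\<mu> \<in> Z" for \<mu>
  proof -
    let ?P = "\<lambda>i j. [:shift_diag A \<mu> i j, loop_term u v 1 i j:]"
    \<comment> \<open>At \<epsilon> = 0 the matrix is A - \<mu>, which is nonsingular for \<mu> in
      \<open>Z\<close>.\<close>
    have "\<not> singular_on S (\<lambda>i j. poly (?P i j) 0)"
      using unit_row_singular_imp[OF fin sym full v u] that by (simp add: Z_def)
    from finite_singular_parameters[OF fin this]
    show ?thesis unfolding B_def by (simp add: shift_diag_def[abs_def] algebra_simps)
  qed
  \<comment> \<open>Excluding \<epsilon> = 0 as well keeps row \<open>v\<close> nonzero at s =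
    0.\<close>
  hence "finite (insert 0 (\<Union>\<mu>\<in>Z. B \<mu>))" using \<open>finite Z\<close> by blast
  then obtain \<epsilon> where "\<epsilon> \<notin> insert 0 (\<Union>\<mu>\<in>Z. B \<mu>)"
    using ex_new_if_finite[OF infinite_UNIV_char_0] by blast
  hence eps: "\<epsilon> \<noteq> 0" "\<And>\<mu>. \<mu> \<in> Z \<Longrightarrow> \<epsilon> \<notin> B \<mu>" by auto
  \<comment> \<open>Row \<open>v\<close> is multiplied by s. A quadratic coefficient occurs only for
    u = v, where the diagonal contains \<epsilon> (s + 1/s).\<close>
  define P where "P \<mu> i j =
      (if i = v then [:if j = u then \<epsilon> else 0, shift_diag A \<mu> i j, if v = u \<and> j = v then \<epsilon> else 0:]
       else [:shift_diag A \<mu> i j, if i = u \<and> j = v then \<epsilon> else 0:])" for \<mu> i j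
  have scaled: "poly (P \<mu> i j) s = (if i = v then s else 1) *
      shift_diag (\<lambda>i j. A i j + \<epsilon> * loop_term u v s i j) \<mu> i j" if "s \<noteq> 0" for \<mu> i j s
    using that
    by (cases "i = v"; cases "i = u"; cases "j = u"; cases "j = v")
      (simp_all add: P_def shift_diag_def loop_term_def algebra_simps)
  have sing: "singular_on S (\<lambda>i j. poly (P \<mu> i j) s)"
    if "s \<noteq> 0" "singular_on S (shift_diag (\<lambda>i j. A i j + \<epsilon> * loop_term u v s i j) \<mu>)" for \<mu> s
    using that(2) unfolding singular_on_def scaled[OF that(1)]
    by (auto simp: mult.assoc simp flip: sum_distrib_left)
  have "\<exists>s0. \<not> singular_on S (\<lambda>i j. poly (P \<mu> i j) s0)" for \<mu>
  proof (cases "\<mu> \<in> Z")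
    case True
    have "(\<lambda>i j. poly (P \<mu> i j) 1) = shift_diag (\<lambda>i j. A i j + \<epsilon> * loop_term u v 1 i j) \<mu>"
      using scaled[of 1] by (simp add: fun_eq_iff)
    hence "\<not> singular_on S (\<lambda>i j. poly (P \<mu> i j) 1)"
      using eps(2)[OF True] unfolding B_def by simp
    thus ?thesis ..
  next
    case False
    have "singular_on S (unit_row v u (shift_diag A \<mu>))" if "singular_on S (\<lambda>i j. poly (P \<mu> i j) 0)"
    proof -
      have eq: "poly (P \<mu> i j) 0 = (if i = v then \<epsilon> else 1) * unit_row v u (shift_diag A \<mu>) i j" for i j
        by (simp add: P_def unit_row_def)
      show ?thesis
        using that eps(1) unfolding singular_on_def eq
        by (auto simp: mult.assoc split: if_splits simp flip: sum_distrib_left)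
    qed
    thus ?thesis using False by (auto simp: Z_def)
  qed
  hence "finite {s. singular_on S (\<lambda>i j. poly (P \<mu> i j) s)}" for \<mu>
    using finite_singular_parameters[OF fin] by blast
  hence "finite {s. s \<noteq> 0 \<and>
    singular_on S (shift_diag (\<lambda>i j. A i j + \<epsilon> * loop_term u v s i j) \<mu>)}" for \<mu>
    by (rule finite_subset[rotated]) (auto intro: sing)
  thus ?thesis by blast
qed

section \<open>Fundamental domains and components\<close>

context periodic_graph
begin

lemma act_inj: "u \<in> verts G \<Longrightarrow> act G u a = act G u b \<Longrightarrow> a = b"
  using act_free[of u "a - b"] act_add[of u a "- b"] act_add[of u b "- b"] act_zero[of u]
  by simp

lemma edge_act_iff: "(act G u b, act G v c) \<in> edges G \<longleftrightarrow> (u, act G v (c - b)) \<in> edges G"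
  if "u \<in> verts G" "v \<in> verts G"
  using that act_edges[of "act G u b" "act G v c" "- b"] act_edges[of u "act G v (c - b)" b]
  by (auto simp: act_zero simp flip: act_add)

lemma edge_flip: "(u, act G v a) \<in> edges G \<longleftrightarrow> (v, act G u (- a)) \<in> edges G"
  if "u \<in> verts G" "v \<in> verts G"
proof -
  have "(u, act G v a) \<in> edges G \<longleftrightarrow> (act G v a, act G u 0) \<in> edges G"
    using edges_sym that by (auto simp: sym_def act_zero)
  thus ?thesis using edge_act_iff[OF that(2,1)] by simp
qed

text \<open>By freeness at \<open>u\<close>, different shifts give edges in different orbits, and
  there are finitely many edge orbits.\<close>

lemma finite_shifts:
  assumes "u \<in> verts G" "v \<in> verts G"
  shows "finite {a. (u, act G v a) \<in> edges G}"
proof (rule finite_imageD)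
  let ?f = "\<lambda>a. edge_orbit G (u, act G v a)"
  show "finite (?f ` {a. (u, act G v a) \<in> edges G})"
    by (rule finite_subset[OF _ finite_edge_orbits]) auto
  show "inj_on ?f {a. (u, act G v a) \<in> edges G}"
  proof (rule inj_onI)
    fix a b assume "?f a = ?f b"
    moreover have "(u, act G v a) \<in> ?f a"
      using assms act_closed act_zero by (force simp: edge_orbit_def intro: exI[of _ 0])
    ultimately obtain c where c: "u = act G u c" "act G v a = act G (act G v b) c"
      by (auto simp: edge_orbit_def)
    have "c = 0" using act_free[of u c] c(1) assms(1) by simp
    thus "a = b" using c(2) act_zero act_closed assms(2) act_inj by metis
  qed
qed

text \<open>Adjacency in the quotient graph, on representatives of the vertex orbits; a loop i = j
  comes from an edge of nonzero shift.\<close>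

definition adjacent :: "'v \<Rightarrow> 'v \<Rightarrow> bool" where
  "adjacent i j \<longleftrightarrow> (\<exists>a. (i, act G j a) \<in> edges G)"

lemma adjacent_sym: "i \<in> verts G \<Longrightarrow> j \<in> verts G \<Longrightarrow> adjacent i j \<Longrightarrow> adjacent j i"
  unfolding adjacent_def using edge_flip by blast

text \<open>Take a maximal subset that carries such data. If it were proper, \<open>conn\<close>
  would give an adjacent vertex to attach as a leaf. The translates by \<open>g\<close> are the
  lifts along the tree, so every nonzero off-diagonal entry of \<open>A\<close> lies on an edge
  between lifts.\<close>

lemma full_eigenvectors_on_connected:
  assumes fin: "finite C" and r: "r \<in> C" and C: "C \<subseteq> verts G"
    and conn: "\<And>S. r \<in> S \<Longrightarrow> S \<subset> C \<Longrightarrow> \<exists>i\<in>S. \<exists>j\<in>C - S. adjacent i j"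
  shows "\<exists>g A. symmetric_on C A \<and> full_eigenvectors C A \<and>
    (\<forall>i\<in>C. \<forall>j\<in>C. i \<noteq> j \<longrightarrow> A i j \<noteq> 0 \<longrightarrow> (act G i (g i), act G j (g j)) \<in> edges G)"
    (is "?P C")
proof -
  define F where "F = {S. r \<in> S \<and> S \<subseteq> C \<and> ?P S}"
  have "?P {r}"
    by (intro exI[of _ "\<lambda>_. 0 :: int ^ 'd"] exI[of _ "\<lambda>_ _. 0 :: complex"])
      (simp add: symmetric_on_def full_eigenvectors_singleton)
  hence "{r} \<in> F" using r by (simp add: F_def)
  moreover have "finite F" using fin by (simp add: F_def)
  ultimately obtain S where SF: "S \<in> F" and max: "\<And>T. T \<in> F \<Longrightarrow> S \<subseteq> T \<Longrightarrow> S = T"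
    using finite_has_maximal2[of F "{r}"] by metis
  hence S: "r \<in> S" "S \<subseteq> C" "?P S" by (simp_all add: F_def)
  have "S = C"
  proof (rule ccontr)
    assume "S \<noteq> C"
    then obtain u w where uw: "u \<in> S" "w \<in> C" "w \<notin> S" "adjacent u w"
      using conn[of S] S(1,2) by blast
    then obtain a where a: "(u, act G w a) \<in> edges G" unfolding adjacent_def by blast
    have finS: "finite S" using S(2) fin finite_subset by blast
    obtain g A where gA: "symmetric_on S A" "full_eigenvectors S A"
      "\<forall>i\<in>S. \<forall>j\<in>S. i \<noteq> j \<longrightarrow> A i j \<noteq> 0 \<longrightarrow> (act G i (g i), act G j (g j)) \<in> edges G"
      using S(3) by auto
    obtain c where c: "full_eigenvectors (insert w S) (add_leaf S A u w c)"
      using full_eigenvectors_add_leaf[OF finS gA(1,2) uw(1,3)] by blast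
    \<comment> \<open>Translating the edge (u, w + a) by \<open>g u\<close> makes it join the lifts
      of \<open>u\<close> and \<open>w\<close>.\<close>
    define g' where "g' = g(w := a + g u)"
    have verts: "u \<in> verts G" "w \<in> verts G" using uw S(2) C by auto
    have uw_edge: "(act G u (g' u), act G w (g' w)) \<in> edges G"
      using a uw edge_act_iff[OF verts] by (auto simp: g'_def)
    have "symmetric_on (insert w S) (add_leaf S A u w c)"
      using gA(1) uw by (auto simp: symmetric_on_def add_leaf_def)
    moreover have "(act G i (g' i), act G j (g' j)) \<in> edges G"
      if ij: "i \<in> insert w S" "j \<in> insert w S" "i \<noteq> j" "add_leaf S A u w c i j \<noteq> 0" for i j
    proof -
      consider "i \<in> S" "j \<in> S" "A i j \<noteq> 0" | "i = u" "j = w" | "i = w" "j = u"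
        using ij by (auto simp: add_leaf_def split: if_splits)
      thus ?thesis
      proof cases
        case 1
        thus ?thesis using gA(3) ij(3) uw(3) by (auto simp: g'_def)
      qed (use uw_edge edges_sym in \<open>auto simp: sym_def\<close>)
    qed
    ultimately have "?P (insert w S)" using c by blast
    hence "insert w S \<in> F" using S(1,2) uw(2) by (simp add: F_def)
    thus False using max[of "insert w S"] uw(3) by blast
  qed
  thus ?thesis using S(3) by simp
qed

section \<open>Change of fundamental domain\<close>

lemma fundamental_domain_rep:
  assumes "fundamental_domain G W" "u \<in> verts G"
  obtains w where "w \<in> W" "w \<in> vertex_orbit G u"
    "\<And>w'. w' \<in> W \<Longrightarrow> w' \<in> vertex_orbit G u \<Longrightarrow> w' = w"
proof -
  have "\<exists>!w. w \<in> W \<and> w \<in> vertex_orbit G u"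
    using assms by (simp add: fundamental_domain_def)
  thus ?thesis using that by (elim ex1E) blast
qed

lemma fundamental_domain_gauge:
  assumes "fundamental_domain G W"
  shows "fundamental_domain G ((\<lambda>i. act G i (g i)) ` W)"
  unfolding fundamental_domain_def
proof (intro conjI ballI)
  show "(\<lambda>i. act G i (g i)) ` W \<subseteq> verts G"
    using assms act_closed unfolding fundamental_domain_def by blast
next
  fix u assume u: "u \<in> verts G"
  obtain w where w: "w \<in> W" "w \<in> vertex_orbit G u" "\<And>w'. w' \<in> W \<Longrightarrow> w' \<in> vertex_orbit G u \<Longrightarrow> w' = w"
    using fundamental_domain_rep[OF assms u] by metis
  \<comment> \<open>Translation does not change the orbit, so the unique representative is carried
    along.\<close>
  have iff: "act G i b \<in> vertex_orbit G u \<longleftrightarrow> i \<in> vertex_orbit G u" if i: "i \<in> verts G" for i b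
  proof
    assume "act G i b \<in> vertex_orbit G u"
    then obtain c where c: "act G i b = act G u c" by (auto simp: vertex_orbit_def)
    have "act G (act G i b) (- b) = act G (act G u c) (- b)" using c by simp
    hence "i = act G u (c + - b)"
      using act_add[OF i, of b "- b"] act_add[OF u, of c "- b"] act_zero[OF i] by simp
    thus "i \<in> vertex_orbit G u" by (auto simp: vertex_orbit_def)
  next
    assume "i \<in> vertex_orbit G u"
    then obtain c where "i = act G u c" by (auto simp: vertex_orbit_def)
    hence "act G i b = act G u (c + b)" using act_add[OF u] by simp
    thus "act G i b \<in> vertex_orbit G u" by (auto simp: vertex_orbit_def)
  qed
  have W: "i \<in> verts G" if "i \<in> W" for i using assms that by (auto simp: fundamental_domain_def)
  show "\<exists>!x. x \<in> (\<lambda>i. act G i (g i)) ` W \<and> x \<in> vertex_orbit G u"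
  proof (rule ex1I[of _ "act G w (g w)"])
    show "act G w (g w) \<in> (\<lambda>i. act G i (g i)) ` W \<and> act G w (g w) \<in> vertex_orbit G u"
      using w(1,2) iff[OF W] by simp
    fix x assume "x \<in> (\<lambda>i. act G i (g i)) ` W \<and> x \<in> vertex_orbit G u"
    then obtain i where i: "i \<in> W" "x = act G i (g i)" "x \<in> vertex_orbit G u" by blast
    hence "i \<in> vertex_orbit G u" using iff[OF W[OF i(1)]] by simp
    thus "x = act G w (g w)" using w(3)[OF i(1)] i(2) by simp
  qed
qed

text \<open>Translating every representative by \<open>g\<close> gives a fundamental domain in which
  \<open>C\<close> becomes a component of support 0. Used contrapositively: if there is no such
  component, any lift of a quotient component has an edge of nonzero shift.\<close>

lemma component_of_support_zero:
  assumes W: "fundamental_domain G W" and C: "C \<subseteq> W" "C \<noteq> {}"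
    and closed: "\<And>i j. i \<in> C \<Longrightarrow> j \<in> W \<Longrightarrow> adjacent i j \<Longrightarrow> j \<in> C"
    and zero: "\<And>u v a. u \<in> C \<Longrightarrow> v \<in> C \<Longrightarrow> (act G u (g u), act G v (g v + a)) \<in> edges G \<Longrightarrow> a = 0"
  shows "\<exists>W U. fundamental_domain G W \<and> is_component G W U \<and> U \<noteq> {} \<and> has_support_zero G U"
proof -
  let ?h = "\<lambda>i. act G i (g i)"
  have verts: "i \<in> verts G" if "i \<in> W" for i using W that by (auto simp: fundamental_domain_def)
  have "is_component G (?h ` W) (?h ` C)"
    unfolding is_component_def
  proof (intro conjI notI)
    show "?h ` C \<subseteq> ?h ` W" using C by blast
    assume "\<exists>u\<in>?h ` C. \<exists>v\<in>?h ` W - ?h ` C. \<exists>a. (u, act G v a) \<in> edges G"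
    then obtain i j a where ij: "i \<in> C" "j \<in> W" "j \<notin> C" "(?h i, act G (?h j) a) \<in> edges G" by blast
    have v: "i \<in> verts G" "j \<in> verts G" using ij C verts by auto
    have "(?h i, act G j (g j + a)) \<in> edges G" using ij(4) v(2) by (simp add: act_add)
    hence "adjacent i j" using edge_act_iff[OF v] unfolding adjacent_def by blast
    thus False using closed ij by blast
  qed
  moreover have "support G (?h ` C) \<subseteq> {0}"
    unfolding support_def using zero C verts by (auto simp flip: act_add)
  hence "has_support_zero G (?h ` C)" unfolding has_support_zero_def by blast
  ultimately show ?thesis using fundamental_domain_gauge[OF W, of g] C(2) by blast
qed

text \<open>The shifts \<open>g\<close> match the representatives of both domains orbit by orbit;
  they relate a component of an arbitrary domain to the listed one.\<close>

lemma fundamental_domain_transport: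
  assumes W: "fundamental_domain G W" and W': "fundamental_domain G W'"
  obtains g where "\<And>i. i \<in> W \<Longrightarrow> act G i (g i) \<in> W'"
    "\<And>u. u \<in> W' \<Longrightarrow> \<exists>i\<in>W. act G i (g i) = u"
proof -
  have verts: "i \<in> verts G" if "i \<in> W \<or> i \<in> W'" for i
    using W W' that by (auto simp: fundamental_domain_def)
  have "\<exists>a. act G i a \<in> W'" if "i \<in> W" for i
  proof -
    obtain w where "w \<in> W'" "w \<in> vertex_orbit G i"
      using fundamental_domain_rep[OF W' verts[of i]] \<open>i \<in> W\<close> by blast
    thus ?thesis by (auto simp: vertex_orbit_def)
  qed
  then obtain g where g: "\<And>i. i \<in> W \<Longrightarrow> act G i (g i) \<in> W'" by metis
  have "\<exists>i\<in>W. act G i (g i) = u" if u: "u \<in> W'" for u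
  proof -
    obtain i where "i \<in> W" "i \<in> vertex_orbit G u"
      using fundamental_domain_rep[OF W, of u] verts[of u] u by metis
    then obtain a where i: "i \<in> W" "i = act G u a" by (auto simp: vertex_orbit_def)
    have "act G i (g i) \<in> vertex_orbit G u"
      using i verts[of u] u by (auto simp: vertex_orbit_def simp flip: act_add)
    moreover have "u \<in> vertex_orbit G u"
      using verts[of u] u act_zero by (force simp: vertex_orbit_def intro: exI[of _ 0])
    ultimately have "act G i (g i) = u"
      using fundamental_domain_rep[OF W', of u] g[OF i(1)] u verts[of u] by metis
    thus ?thesis using i by blast
  qed
  thus ?thesis using g that by blast
qed

text \<open>Every vertex is uniquely w + b with w in \<open>W\<close>. An edge receives the label of
  its two representatives at the difference of their shifts: this is translation invariant, and the
  condition on \<open>k\<close> is invariance under reversal.\<close>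

lemma labeling_exists:
  assumes W: "fundamental_domain G W" and k: "\<And>i j b. k i j b = k j i (- b)"
  shows "\<exists>l\<in>labelings G. (\<forall>i\<in>W. fst l i = p i) \<and>
    (\<forall>i\<in>W. \<forall>j\<in>W. \<forall>b. (i, act G j b) \<in> edges G \<longrightarrow> snd l (i, act G j b) = k i j b)"
proof -
  define rp where "rp x = (THE w. w \<in> W \<and> w \<in> vertex_orbit G x)" for x
  define sh where "sh x = (THE b. act G (rp x) b = x)" for x
  have verts: "i \<in> verts G" if "i \<in> W" for i using W that by (auto simp: fundamental_domain_def)
  have rp: "rp (act G w b) = w" if "w \<in> W" for w b
  proof -
    have "w \<in> vertex_orbit G (act G w b)"
      unfolding vertex_orbit_def using act_add[OF verts[OF that], of b "- b"] act_zero[OF verts[OF that]]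
      by (intro CollectI exI[of _ "- b"]) simp
    thus ?thesis
      unfolding rp_def using W that act_closed[OF verts[OF that], of b]
      by (intro the1_equality) (auto simp: fundamental_domain_def)
  qed
  have sh: "sh (act G w b) = b" if "w \<in> W" for w b
    unfolding sh_def rp[OF that] using act_inj verts[OF that] by blast
  have rep: "\<exists>w\<in>W. \<exists>b. x = act G w b" if "x \<in> verts G" for x
  proof -
    obtain w where "w \<in> W" "w \<in> vertex_orbit G x"
      using fundamental_domain_rep[OF W \<open>x \<in> verts G\<close>] by blast
    then obtain c where c: "w \<in> W" "w = act G x c" by (auto simp: vertex_orbit_def)
    have "act G w (- c) = x" using act_add[OF that, of c "- c"] act_zero[OF that] c(2) by simp
    thus ?thesis using c(1) by metis
  qed
  have shift: "rp (act G x a) = rp x" "sh (act G x a) = sh x + a" if x: "x \<in> verts G" for x a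
    using rep[OF x] rp sh verts by (auto simp flip: act_add)
  define V where "V x = (if x \<in> verts G then p (rp x) else 0)" for x
  define E where "E e = (if e \<in> edges G then
    k (rp (fst e)) (rp (snd e)) (sh (snd e) - sh (fst e)) else 0)" for e
  have "(V, E) \<in> labelings G"
    unfolding labelings_def
  proof (clarsimp, intro conjI allI ballI impI, safe)
    fix u v a assume e: "(u, v) \<in> edges G"
    hence uv: "u \<in> verts G" "v \<in> verts G" using edges_subset by auto
    show "E (u, v) = E (v, u)"
      using e edges_sym k[of "rp u" "rp v"] by (auto simp: E_def sym_def)
    show "E (act G u a, act G v a) = E (u, v)"
      using e act_edges shift uv by (simp add: E_def)
  qed (auto simp: V_def E_def shift act_closed)
  moreover have "V i = p i" if "i \<in> W" for i
    using rp[OF that, of 0] verts[OF that] act_zero by (simp add: V_def)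
  moreover have "E (i, act G j b) = k i j b" if "i \<in> W" "j \<in> W" "(i, act G j b) \<in> edges G" for i j b
    using that rp[OF that(1), of 0] sh[OF that(1), of 0] verts[OF that(1)] rp[OF that(2)] sh[OF that(2)]
    by (simp add: E_def act_zero)
  ultimately show ?thesis by (intro bexI[of _ "(V, E)"]) auto
qed

section \<open>Connected components of the quotient graph\<close>

definition quotient_component :: "'v set \<Rightarrow> 'v \<Rightarrow> 'v set" where
  "quotient_component W r = {j \<in> W. (r, j) \<in> {(i, j). i \<in> W \<and> j \<in> W \<and> adjacent i j}\<^sup>*}"

lemma quotient_component_self: "r \<in> W \<Longrightarrow> r \<in> quotient_component W r"
  by (simp add: quotient_component_def)

lemma quotient_component_subset: "quotient_component W r \<subseteq> W"
  by (auto simp: quotient_component_def)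

lemma quotient_component_closed:
  "i \<in> quotient_component W r \<Longrightarrow> j \<in> W \<Longrightarrow> adjacent i j \<Longrightarrow> j \<in> quotient_component W r"
  unfolding quotient_component_def by (auto intro: rtrancl_into_rtrancl)

lemma quotient_component_eq:
  assumes "W \<subseteq> verts G" "j \<in> quotient_component W r"
  shows "quotient_component W j = quotient_component W r"
proof -
  let ?R = "{(i, j). i \<in> W \<and> j \<in> W \<and> adjacent i j}"
  have "sym ?R" using assms(1) adjacent_sym by (auto simp: sym_def)
  hence "sym (?R\<^sup>*)" by (rule sym_rtrancl)
  with assms(2) show ?thesis
    unfolding quotient_component_def by (auto dest: symD intro: rtrancl_trans)
qed

text \<open>A path from \<open>r\<close> cannot leave \<open>S\<close> without a crossing pair. This
  is the growth condition \<open>conn\<close> of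
  \<open>full_eigenvectors_on_connected\<close>.\<close>

lemma quotient_component_connected:
  assumes "r \<in> S" "S \<subset> quotient_component W r"
  shows "\<exists>i\<in>S. \<exists>j\<in>quotient_component W r - S. adjacent i j"
proof (rule ccontr)
  assume none: "\<not> ?thesis"
  obtain w where w: "w \<in> quotient_component W r" "w \<notin> S" using assms by blast
  have "(r, w) \<in> {(i, j). i \<in> W \<and> j \<in> W \<and> adjacent i j}\<^sup>*"
    using w by (simp add: quotient_component_def)
  hence "w \<in> S"
  proof (induction rule: rtrancl_induct)
    case base
    show ?case by (rule assms(1))
  next
    case (step y z)
    have "z \<in> quotient_component W r"
      using quotient_component_closed[of y W r z] assms(2) step by auto
    thus ?case using none step by blast
  qed
  thus False using w by blast
qed

end

section \<open>Common roots as a polynomial condition\<close>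

(* The linear system p a + q b = 0 for the coefficients of a and b of degree < n. *)
definition sylvester_matrix :: "nat \<Rightarrow> complex poly \<Rightarrow> complex poly \<Rightarrow> nat \<Rightarrow> nat \<Rightarrow> complex" where
  "sylvester_matrix n p q k j =
     (if j < n then if j \<le> k then coeff p (k - j) else 0
      else if j - n \<le> k then coeff q (k - (j - n)) else 0)"

text \<open>The first \<open>n\<close> unknowns are the coefficients of a, the last \<open>n\<close>
  those of b, and row \<open>k\<close> is the coefficient of degree \<open>k\<close> in p a + q
  b.\<close>

lemma sylvester_matrix_apply:
  "(\<Sum>j<2 * n. sylvester_matrix n p q k j * x j) =
     coeff (p * (\<Sum>j<n. monom (x j) j) + q * (\<Sum>j<n. monom (x (n + j)) j)) k"
proof -
  have mult: "coeff (r * (\<Sum>j<n. monom (y j) j)) k =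
      (\<Sum>j<n. (if j \<le> k then coeff r (k - j) else 0) * y j)" for r and y :: "nat \<Rightarrow> complex"
    unfolding sum_distrib_left coeff_sum
    by (intro sum.cong) (auto simp: mult.commute[of r] coeff_monom_mult)
  have split: "{..<2 * n} = {..<n} \<union> {n..<2 * n}" by auto
  have "(\<Sum>j<2 * n. sylvester_matrix n p q k j * x j) =
      (\<Sum>j<n. sylvester_matrix n p q k j * x j) + (\<Sum>j\<in>{n..<2 * n}. sylvester_matrix n p q k j * x j)"
    unfolding split by (rule sum.union_disjoint) auto
  also have "(\<Sum>j\<in>{n..<2 * n}. sylvester_matrix n p q k j * x j) =
      (\<Sum>j<n. sylvester_matrix n p q k (n + j) * x (n + j))"
    by (rule sum.reindex_bij_witness[of _ "\<lambda>j. n + j" "\<lambda>j. j - n"]) auto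
  finally show ?thesis
    unfolding coeff_add mult by (simp add: sylvester_matrix_def cong: if_cong)
qed

lemma degree_sum_monom_less:
  "n > 0 \<Longrightarrow> degree (\<Sum>j<n. monom (c j :: complex) j) < n"
  by (rule degree_sum_less) (auto intro: le_less_trans[OF degree_monom_le])

lemma sum_monom_coeff:
  assumes "degree (p :: complex poly) < n"
  shows "(\<Sum>j<n. monom (coeff p j) j) = p"
  by (rule poly_eqI) (use assms in \<open>auto simp: coeff_sum sum.delta coeff_eq_0\<close>)

text \<open>A kernel vector gives q b = - p a with b \<noteq> 0 and deg b < deg p; without a common
  root p and q are coprime and p would divide b. Conversely, removing a common linear factor leaves
  p' and q' with p q' - q p' = 0.\<close>

lemma sylvester_matrix_singular_iff:
  assumes p: "degree p = n" and q: "degree q = n" and n: "n > 0"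
  shows "singular_on {..<2 * n} (sylvester_matrix n p q) \<longleftrightarrow> (\<exists>\<mu>. poly p \<mu> = 0 \<and> poly q \<mu> = 0)"
proof
  assume "singular_on {..<2 * n} (sylvester_matrix n p q)"
  then obtain x where x: "\<exists>j<2 * n. x j \<noteq> 0"
    "\<And>k. k < 2 * n \<Longrightarrow> (\<Sum>j<2 * n. sylvester_matrix n p q k j * x j) = 0"
    unfolding singular_on_def by auto
  define a where "a = (\<Sum>j<n. monom (x j) j)"
  define b where "b = (\<Sum>j<n. monom (x (n + j)) j)"
  have deg: "degree a < n" "degree b < n" unfolding a_def b_def using degree_sum_monom_less[OF n] by auto
  have "p * a + q * b = 0"
  proof (rule poly_eqI)
    fix k
    have "degree (p * a + q * b) < 2 * n"
      using degree_mult_le[of p a] degree_mult_le[of q b] deg p q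
      by (intro degree_add_less) auto
    thus "coeff (p * a + q * b) k = coeff 0 k"
      using x(2)[of k] unfolding sylvester_matrix_apply a_def[symmetric] b_def[symmetric]
      by (cases "k < 2 * n") (simp_all add: coeff_eq_0 del: coeff_add)
  qed
  hence eq: "q * b = p * (- a)" by (simp add: eq_neg_iff_add_eq_0 add.commute)
  \<comment> \<open>The entries of the kernel vector are the coefficients of \<open>a\<close> and
    \<open>b\<close>, so these cannot both be 0.\<close>
  have "b \<noteq> 0 \<or> a \<noteq> 0"
  proof (rule ccontr)
    assume "\<not> ?thesis"
    hence 0: "a = 0" "b = 0" by auto
    have "x j = coeff a j" "x (n + j) = coeff b j" if "j < n" for j
      using that by (auto simp: a_def b_def coeff_sum sum.delta)
    hence "x j = 0" "x (n + j) = 0" if "j < n" for j using that 0 by auto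
    hence "x j = 0" if "j < 2 * n" for j using that
      by (cases "j < n") (use add_diff_inverse_nat[of j n] in \<open>auto, metis add_less_cancel_left mult_2\<close>)
    thus False using x(1) by blast
  qed
  hence b: "b \<noteq> 0" using eq p n by auto
  show "\<exists>\<mu>. poly p \<mu> = 0 \<and> poly q \<mu> = 0"
  proof (rule ccontr)
    assume none: "\<not> ?thesis"
    \<comment> \<open>A nonconstant gcd would have a complex root, common to \<open>p\<close> and
      \<open>q\<close>.\<close>
    have "degree (gcd p q) = 0"
    proof (rule ccontr)
      assume "degree (gcd p q) \<noteq> 0"
      hence "\<not> constant (poly (gcd p q))" by (simp add: constant_degree)
      then obtain \<mu> where "poly (gcd p q) \<mu> = 0" using fundamental_theorem_of_algebra by blast
      hence "[:- \<mu>, 1:] dvd gcd p q" by (simp add: poly_eq_0_iff_dvd)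
      hence "[:- \<mu>, 1:] dvd p" "[:- \<mu>, 1:] dvd q" by (auto intro: dvd_trans)
      thus False using none by (auto simp: poly_eq_0_iff_dvd)
    qed
    moreover have "gcd p q \<noteq> 0" using p n by auto
    ultimately have "coprime p q"
      by (metis coprime_iff_gcd_eq_1 is_unit_gcd is_unit_iff_degree)
    moreover have "p dvd q * b" using eq by simp
    ultimately have "p dvd b" by (simp add: coprime_dvd_mult_right_iff)
    hence "degree p \<le> degree b" using b by (rule dvd_imp_degree_le)
    thus False using deg p by simp
  qed
next
  assume "\<exists>\<mu>. poly p \<mu> = 0 \<and> poly q \<mu> = 0"
  then obtain \<mu> where "[:- \<mu>, 1:] dvd p" "[:- \<mu>, 1:] dvd q" by (auto simp: poly_eq_0_iff_dvd)
  then obtain p' q' where pq: "p = [:- \<mu>, 1:] * p'" "q = [:- \<mu>, 1:] * q'" by (auto elim!: dvdE)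
  have nz: "p' \<noteq> 0" "q' \<noteq> 0" using pq p q n by auto
  have deg: "degree p' < n" "degree q' < n"
    using p q nz unfolding pq by (auto simp: degree_mult_eq simp del: mult_pCons_left)
  define x where "x j = (if j < n then coeff q' j else coeff (- p') (j - n))" for j
  have "(\<Sum>j<n. monom (x j) j) = q'" "(\<Sum>j<n. monom (x (n + j)) j) = - p'"
    using sum_monom_coeff[OF deg(2)] sum_monom_coeff[of "- p'" n] deg(1) by (simp_all add: x_def)
  moreover have "c * p' * q' + c * q' * (- p') = 0" for c :: "complex poly"
    by (simp add: mult_ac)
  hence "p * q' + q * (- p') = 0" unfolding pq .
  ultimately have "(\<Sum>j<2 * n. sylvester_matrix n p q k j * x j) = 0" for k
    unfolding sylvester_matrix_apply by simp
  moreover have "\<exists>j\<in>{..<2 * n}. x j \<noteq> 0"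
    using deg(2) nz(2) by (intro bexI[of _ "degree q'"]) (auto simp: x_def)
  ultimately show "singular_on {..<2 * n} (sylvester_matrix n p q)"
    unfolding singular_on_def by blast
qed

text \<open>The Leibniz formula, for an arbitrary class of functions closed under the ring
  operations. It is applied to complex-valued and to polynomial-valued functions.\<close>

lemma det_closed:
  fixes M :: "'l \<Rightarrow> 'a :: comm_ring_1 mat"
  assumes const: "\<And>c. P (\<lambda>_. c)"
    and add: "\<And>f g. P f \<Longrightarrow> P g \<Longrightarrow> P (\<lambda>l. f l + g l)"
    and mult: "\<And>f g. P f \<Longrightarrow> P g \<Longrightarrow> P (\<lambda>l. f l * g l)"
    and dim: "\<And>l. M l \<in> carrier_mat n n"
    and entries: "\<And>i j. i < n \<Longrightarrow> j < n \<Longrightarrow> P (\<lambda>l. M l $$ (i, j))"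
  shows "P (\<lambda>l. det (M l))"
proof -
  have sum: "P (\<lambda>l. \<Sum>i\<in>A. f i l)" if "\<And>i. i \<in> A \<Longrightarrow> P (f i)" for A and f :: "(nat \<Rightarrow> nat) \<Rightarrow> 'l \<Rightarrow> 'a"
    using that by (induction A rule: infinite_finite_induct) (auto intro: const add)
  have prod: "P (\<lambda>l. \<Prod>i\<in>A. f i l)" if "\<And>i. i \<in> A \<Longrightarrow> P (f i)" for A and f :: "nat \<Rightarrow> 'l \<Rightarrow> 'a"
    using that by (induction A rule: infinite_finite_induct) (auto intro: const mult)
  have "P (\<lambda>l. \<Prod>i = 0..<n. M l $$ (i, p i))" if "p permutes {0..<n}" for p
    by (rule prod) (use permutes_in_image[OF that] in \<open>auto intro: entries\<close>)
  hence "P (\<lambda>l. \<Sum>p\<in>{p. p permutes {0..<n}}. signof p * (\<Prod>i = 0..<n. M l $$ (i, p i)))"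
    by (intro sum mult const) auto
  thus ?thesis by (simp add: det_def'[OF dim])
qed

lemma polynomial_functions_sum:
  assumes "\<And>i. i \<in> A \<Longrightarrow> f i \<in> polynomial_functions G"
  shows "(\<lambda>l. \<Sum>i\<in>A. f i l) \<in> polynomial_functions G"
  using assms
  by (induction A rule: infinite_finite_induct)
    (auto intro: polynomial_functions.const polynomial_functions.add)

lemma polynomial_functions_det:
  assumes "\<And>l. M l \<in> carrier_mat n n"
    and "\<And>i j. i < n \<Longrightarrow> j < n \<Longrightarrow> (\<lambda>l. M l $$ (i, j)) \<in> polynomial_functions G"
  shows "(\<lambda>l. det (M l)) \<in> polynomial_functions G"
  using det_closed[of "\<lambda>f. f \<in> polynomial_functions G" M n] assms
  by (auto intro: polynomial_functions.intros)

text \<open>The closed class consists of the polynomial-valued functions all of whose coefficients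
  are polynomial in the labels; products stay in it by the convolution formula.\<close>

lemma polynomial_functions_coeff_char_poly:
  assumes dim: "\<And>l. M l \<in> carrier_mat n n"
    and entries: "\<And>i j. i < n \<Longrightarrow> j < n \<Longrightarrow> (\<lambda>l. M l $$ (i, j)) \<in> polynomial_functions G"
  shows "(\<lambda>l. coeff (char_poly (M l)) k) \<in> polynomial_functions G"
proof -
  let ?P = "\<lambda>f. \<forall>k. (\<lambda>l. coeff (f l) k) \<in> polynomial_functions G"
  have "?P (\<lambda>l. det (char_poly_matrix (M l)))"
  proof (rule det_closed[of ?P])
    fix f g :: "_ \<Rightarrow> complex poly" assume "?P f" "?P g"
    thus "?P (\<lambda>l. f l * g l)"
      unfolding coeff_mult by (intro allI polynomial_functions_sum polynomial_functions.mult) auto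
  next
    show "char_poly_matrix (M l) \<in> carrier_mat n n" for l using dim by simp
  next
    fix i j assume ij: "i < n" "j < n"
    show "?P (\<lambda>l. char_poly_matrix (M l) $$ (i, j))"
    proof
      fix k
      have "coeff (char_poly_matrix (M l) $$ (i, j)) k =
          coeff (if i = j then [:0, 1:] else 0) k + (if k = 0 then -1 else 0) * M l $$ (i, j)" for l
        using ij dim[of l] by (auto simp: char_poly_matrix_def coeff_pCons split: nat.split)
      hence eq: "(\<lambda>l. coeff (char_poly_matrix (M l) $$ (i, j)) k) =
          (\<lambda>l. coeff (if i = j then [:0, 1:] else 0) k + (if k = 0 then -1 else 0) * M l $$ (i, j))"
        by (rule ext)
      show "(\<lambda>l. coeff (char_poly_matrix (M l) $$ (i, j)) k) \<in> polynomial_functions G"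
        unfolding eq by (intro polynomial_functions.intros entries ij)
    qed
  qed (auto intro: polynomial_functions.intros)
  thus ?thesis by (simp add: char_poly_def)
qed

section \<open>Evaluation of Laurent polynomials along a one-parameter curve\<close>

definition pairing :: "int ^ 'd \<Rightarrow> int ^ 'd \<Rightarrow> int" where
  "pairing m a = (\<Sum>i\<in>UNIV. m $ i * a $ i)"

lemma pairing_add: "pairing m (a + b) = pairing m a + pairing m b"
  by (simp add: pairing_def algebra_simps sum.distrib)

lemma pairing_minus: "pairing m (- a) = - pairing m a"
  by (simp add: pairing_def sum_negf)

lemma pairing_diff: "pairing m (a - b) = pairing m a - pairing m b"
  by (simp add: pairing_def algebra_simps sum_subtractf)

lemma pairing_zero [simp]: "pairing m 0 = 0"
  by (simp add: pairing_def)

text \<open>Induction on \<open>F\<close>: if m is orthogonal to the new vector a, replace it by k m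
  + a. Its pairing with a is a . a \<noteq> 0, and each earlier vector excludes at most one integer
  k.\<close>

lemma direction_exists:
  assumes "finite F" "0 \<notin> F"
  shows "\<exists>m :: int ^ 'd. \<forall>a\<in>F. pairing m a \<noteq> 0"
  using assms
proof (induction F rule: finite_induct)
  case (insert a F)
  then obtain m where m: "\<forall>b\<in>F. pairing m b \<noteq> 0" by auto
  have comb: "pairing (\<chi> i. k * m $ i + a $ i) b = k * pairing m b + pairing a b" for k b
    by (simp add: pairing_def algebra_simps sum.distrib sum_distrib_left)
  have aa: "pairing a a \<noteq> 0"
  proof
    assume "pairing a a = 0"
    hence "a = 0" by (simp add: pairing_def sum_nonneg_eq_0_iff Finite_Cartesian_Product.vec_eq_iff)
    thus False using insert.prems by simp
  qed
  show ?case
  proof (cases "pairing m a = 0")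
    case True
    have "finite (\<Union>b\<in>F. {k :: int. k * pairing m b + pairing a b = 0})"
    proof (rule finite_UN_I[OF insert.hyps(1)])
      fix b assume "b \<in> F"
      hence "k = k'" if "k * pairing m b + pairing a b = 0" "k' * pairing m b + pairing a b = 0" for k k'
        using that m by (metis add_right_cancel mult_right_cancel)
      hence "{k. k * pairing m b + pairing a b = 0} \<subseteq> {THE k. k * pairing m b + pairing a b = 0}"
        by (auto intro: the_equality[symmetric])
      thus "finite {k. k * pairing m b + pairing a b = 0}" using finite_subset by blast
    qed
    then obtain k where "k \<notin> (\<Union>b\<in>F. {k :: int. k * pairing m b + pairing a b = 0})"
      using ex_new_if_finite[OF infinite_UNIV_char_0] by blast
    hence "\<forall>b\<in>insert a F. pairing (\<chi> i. k * m $ i + a $ i) b \<noteq> 0"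
      using True aa unfolding comb by auto
    thus ?thesis by blast
  qed (use m in auto)
qed auto

text \<open>Evaluation at z = (t^m_1, ..., t^m_d), where z^a becomes t to the power
  \<open>pairing m a\<close>.\<close>

definition eval_laurent :: "int ^ 'd \<Rightarrow> complex \<Rightarrow> 'd::finite laurent \<Rightarrow> complex" where
  "eval_laurent m t f = (\<Sum>a\<in>Poly_Mapping.keys f. Poly_Mapping.lookup f a * t powi pairing m a)"

lemma eval_laurent_superset:
  assumes "finite A" "Poly_Mapping.keys f \<subseteq> A"
  shows "eval_laurent m t f = (\<Sum>a\<in>A. Poly_Mapping.lookup f a * t powi pairing m a)"
  unfolding eval_laurent_def
  by (rule sum.mono_neutral_left) (use assms in \<open>auto simp: in_keys_iff\<close>)

lemma eval_laurent_single [simp]: "eval_laurent m t (Poly_Mapping.single a c) = c * t powi pairing m a"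
  by (simp add: eval_laurent_superset[of "{a}"])

lemma eval_laurent_add: "eval_laurent m t (f + g) = eval_laurent m t f + eval_laurent m t g"
proof -
  let ?A = "Poly_Mapping.keys f \<union> Poly_Mapping.keys g"
  have "eval_laurent m t (f + g) = (\<Sum>a\<in>?A. Poly_Mapping.lookup (f + g) a * t powi pairing m a)"
    by (rule eval_laurent_superset) (use Poly_Mapping.keys_add[of f g] in auto)
  also have "\<dots> = eval_laurent m t f + eval_laurent m t g"
    by (simp add: eval_laurent_superset[of ?A] lookup_add algebra_simps sum.distrib)
  finally show ?thesis .
qed

lemma eval_laurent_zero [simp]: "eval_laurent m t 0 = 0"
  by (simp add: eval_laurent_def)

lemma eval_laurent_sum: "eval_laurent m t (\<Sum>i\<in>A. f i) = (\<Sum>i\<in>A. eval_laurent m t (f i))"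
  by (induction A rule: infinite_finite_induct) (auto simp: eval_laurent_add)

lemma laurent_sum_single:
  "f = (\<Sum>a\<in>Poly_Mapping.keys f. Poly_Mapping.single a (Poly_Mapping.lookup f a))"
  by (rule poly_mapping_eqI)
    (auto simp: lookup_sum lookup_single when_def in_keys_iff)

text \<open>Expand both factors into monomials; for t \<noteq> 0 integer powers of t turn sums of
  exponents into products.\<close>

lemma eval_laurent_mult:
  assumes "t \<noteq> 0"
  shows "eval_laurent m t (f * g) = eval_laurent m t f * eval_laurent m t g"
proof -
  let ?s = "\<lambda>f a. Poly_Mapping.single a (Poly_Mapping.lookup f a)"
  have "f * g = (\<Sum>a\<in>Poly_Mapping.keys f. \<Sum>b\<in>Poly_Mapping.keys g. ?s f a * ?s g b)"
    unfolding sum_product[symmetric]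
    by (rule arg_cong2[OF laurent_sum_single laurent_sum_single])
  thus ?thesis
    by (simp add: eval_laurent_sum mult_single pairing_add power_int_add assms
      eval_laurent_def[of m t f] eval_laurent_def[of m t g] sum_product algebra_simps)
qed

lemma eval_laurent_hom: "t \<noteq> 0 \<Longrightarrow> comm_ring_hom (eval_laurent m t)"
  by unfold_locales (auto simp: eval_laurent_add eval_laurent_mult simp flip: single_one)

section \<open>The Floquet matrix\<close>

context periodic_graph
begin

text \<open>The Floquet matrix on the curve z = (t^m_1, ..., t^m_d), indexed by vertices instead of
  list positions.\<close>

definition floquet_at :: "int ^ 'd \<Rightarrow> complex \<Rightarrow> 'v labeling \<Rightarrow> 'v \<Rightarrow> 'v \<Rightarrow> complex" where
  "floquet_at m t l i j = (if i = j then fst l i else 0) +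
     (\<Sum>a\<in>{a. (i, act G j a) \<in> edges G}. snd l (i, act G j a) * t powi pairing m a)"

lemma eval_floquet_matrix_index:
  assumes "i < length ws" "j < length ws" "distinct ws"
  shows "eval_laurent m t (floquet_matrix G ws l $$ (i, j)) = floquet_at m t l (ws ! i) (ws ! j)"
  using assms
  by (auto simp: floquet_matrix_def floquet_at_def eval_laurent_add eval_laurent_sum nth_eq_iff_index_eq)

text \<open>A linear factor makes det(L(z) - c I) vanish as a Laurent polynomial, so the same c is
  an eigenvalue at every point of every curve.\<close>

lemma linear_factor_imp_common_eigenvalue:
  assumes "distinct ws" and "has_linear_factor (dispersion_polynomial G ws l)"
  shows "\<exists>c. \<forall>m t. t \<noteq> 0 \<longrightarrow> singular_on (set ws) (shift_diag (floquet_at m t l) c)"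
proof -
  let ?n = "length ws"
  let ?A = "map_mat (\<lambda>c. [:c:]) (floquet_matrix G ws l) - [:0, 1:] \<cdot>\<^sub>m 1\<^sub>m ?n"
  obtain c where "[:- Poly_Mapping.single 0 c, 1:] dvd dispersion_polynomial G ws l"
    using assms(2) unfolding has_linear_factor_def by blast
  hence 0: "poly (det ?A) (Poly_Mapping.single 0 c) = 0"
    by (simp add: poly_eq_0_iff_dvd dispersion_polynomial_def)
  have "singular_on (set ws) (shift_diag (floquet_at m t l) c)" if "t \<noteq> 0" for m t
  proof -
    let ?h = "\<lambda>p. poly p (Poly_Mapping.single (0 :: int ^ 'd) c)"
    \<comment> \<open>First \<lambda> = c, then z on the curve; both substitutions are ring
      homomorphisms and commute with \<open>det\<close>.\<close>
    have "list_mat ws (shift_diag (floquet_at m t l) c) = map_mat (eval_laurent m t) (map_mat ?h ?A)"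
    proof (rule eq_matI)
      fix i j assume "i < dim_row (map_mat (eval_laurent m t) (map_mat ?h ?A))"
        "j < dim_col (map_mat (eval_laurent m t) (map_mat ?h ?A))"
      hence ij: "i < ?n" "j < ?n" by auto
      have "eval_laurent m t (p - q) = eval_laurent m t p - eval_laurent m t q" for p q
        using eval_laurent_add[of m t "p - q" q] by simp
      thus "list_mat ws (shift_diag (floquet_at m t l) c) $$ (i, j) =
          map_mat (eval_laurent m t) (map_mat ?h ?A) $$ (i, j)"
        using ij eval_floquet_matrix_index[OF ij assms(1), of m t l] assms(1)
        by (auto simp: list_mat_def shift_diag_def nth_eq_iff_index_eq floquet_matrix_def)
    qed (auto simp: list_mat_def)
    moreover have "det (map_mat (eval_laurent m t) (map_mat ?h ?A)) = 0"
      unfolding comm_ring_hom.hom_det[OF eval_laurent_hom[OF that]]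
        comm_ring_hom.hom_det[OF eval_poly_hom] 0 by simp
    ultimately show ?thesis using singular_on_iff_det[OF assms(1)] by metis
  qed
  thus ?thesis by blast
qed

lemma polynomial_functions_floquet_at:
  assumes "i \<in> verts G"
  shows "(\<lambda>l. floquet_at m t l i j) \<in> polynomial_functions G"
proof -
  have "(\<lambda>l. if i = j then fst l i else 0) \<in> polynomial_functions G"
    using assms by (cases "i = j") (auto intro: polynomial_functions.intros)
  thus ?thesis
    unfolding floquet_at_def
    by (intro polynomial_functions.add polynomial_functions_sum polynomial_functions.mult)
      (auto intro: polynomial_functions.intros)
qed

section \<open>Gauge transformation of a component\<close>

lemma sum_shift_delta:
  fixes p :: "int ^ 'd"
  assumes "finite B" "x - p \<in> B"
  shows "(\<Sum>b\<in>B. (if b + p = x then y else 0) * f (b + p)) = y * (f x :: complex)"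
proof -
  have "(\<Sum>b\<in>B. (if b + p = x then y else 0) * f (b + p)) = (\<Sum>b\<in>B. if b = x - p then y * f x else 0)"
    by (intro sum.cong) (auto simp: algebra_simps)
  thus ?thesis using assms by simp
qed

(* Edge labels on one component in the gauged coordinates: A on the edges of shift 0, and \<epsilon> on the
   edge (u, v + a) together with its reversal (v, u - a). *)
definition block_coeff :: "('v \<Rightarrow> 'v \<Rightarrow> complex) \<Rightarrow> 'v \<Rightarrow> 'v \<Rightarrow> int ^ 'd \<Rightarrow> complex \<Rightarrow> 'v \<Rightarrow> 'v \<Rightarrow> int ^ 'd \<Rightarrow> complex" where
  "block_coeff A u v a \<epsilon> i j b =
     (if b = 0 then (if i = j then 0 else A i j) else 0) +
     ((if b = a then (if i = u \<and> j = v then \<epsilon> else 0) else 0) +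
      (if b = - a then (if i = v \<and> j = u then \<epsilon> else 0) else 0))"

text \<open>Conjugating by the diagonal matrix with entries z^(g i) replaces each shift b by the
  gauged shift b + g i - g j. The edges of gauged shift 0 then contribute \<open>A\<close>, and the
  marked edge with its reversal contributes the loop term.\<close>

lemma floquet_block:
  assumes verts: "i \<in> verts G" "j \<in> verts G" "u \<in> verts G" "v \<in> verts G" and t: "t \<noteq> 0"
    and V: "fst l i = A i i"
    and E: "\<And>b. (i, act G j b) \<in> edges G \<Longrightarrow>
      snd l (i, act G j b) = block_coeff A u v a \<epsilon> i j (b + (g i - g j))"
    and tree: "i \<noteq> j \<Longrightarrow> A i j \<noteq> 0 \<Longrightarrow> (act G i (g i), act G j (g j)) \<in> edges G"
    and loop: "(act G u (g u), act G v (g v + a)) \<in> edges G"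
  shows "floquet_at m t l i j * t powi pairing m (g i - g j) =
    A i j + \<epsilon> * loop_term u v (t powi pairing m a) i j"
proof -
  let ?B = "{b. (i, act G j b) \<in> edges G}" and ?p = "g i - g j"
  let ?f = "\<lambda>b. t powi pairing m b"
  have fin: "finite ?B" by (rule finite_shifts[OF verts(1,2)])
  have B: "x - ?p \<in> ?B" if "(act G i (g i), act G j (g j + x)) \<in> edges G" for x
    using that edge_act_iff[OF verts(1,2)] by (simp add: algebra_simps)
  have s1: "(\<Sum>b\<in>?B. (if b + ?p = 0 then (if i = j then 0 else A i j) else 0) * ?f (b + ?p)) =
      (if i = j then 0 else A i j)"
  proof (cases "i = j \<or> A i j = 0")
    case False
    thus ?thesis using sum_shift_delta[OF fin B[of 0], of "A i j" ?f] tree by simp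
  qed (auto intro!: sum.neutral)
  have s2: "(\<Sum>b\<in>?B. (if b + ?p = a then (if i = u \<and> j = v then \<epsilon> else 0) else 0) * ?f (b + ?p)) =
      (if i = u \<and> j = v then \<epsilon> else 0) * ?f a"
  proof (cases "i = u \<and> j = v")
    case True
    thus ?thesis using sum_shift_delta[OF fin B[of a]] loop by simp
  qed (auto intro!: sum.neutral)
  \<comment> \<open>The reversed edge, whose gauged shift is - a.\<close>
  have loop': "(act G v (g v), act G u (g u - a)) \<in> edges G"
    using loop edge_act_iff[OF verts(3,4), of "g u" "g v + a"] edge_flip[OF verts(3,4)]
      edge_act_iff[OF verts(4,3), of "g v" "g u - a"] by (simp add: algebra_simps)
  have s3: "(\<Sum>b\<in>?B. (if b + ?p = - a then (if i = v \<and> j = u then \<epsilon> else 0) else 0) * ?f (b + ?p)) =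
      (if i = v \<and> j = u then \<epsilon> else 0) * ?f (- a)"
  proof (cases "i = v \<and> j = u")
    case True
    thus ?thesis using sum_shift_delta[OF fin B[of "- a"]] loop' by simp
  qed (auto intro!: sum.neutral)
  have "(\<Sum>b\<in>?B. snd l (i, act G j b) * ?f b) * ?f ?p =
      (\<Sum>b\<in>?B. block_coeff A u v a \<epsilon> i j (b + ?p) * ?f (b + ?p))"
    unfolding sum_distrib_right
    by (intro sum.cong) (use E t in \<open>auto simp: pairing_add power_int_add mult.assoc\<close>)
  also have "\<dots> = (if i = j then 0 else A i j) + ((if i = u \<and> j = v then \<epsilon> else 0) * ?f a +
      (if i = v \<and> j = u then \<epsilon> else 0) * ?f (- a))"
    unfolding block_coeff_def distrib_right sum.distrib s1 s2 s3 ..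
  finally have edge_sum: "(\<Sum>b\<in>?B. snd l (i, act G j b) * ?f b) * ?f ?p = \<dots>" .
  \<comment> \<open>On the diagonal the gauge factor is 1.\<close>
  have diag: "(if i = j then fst l i else 0) * ?f ?p = (if i = j then A i j else 0)"
    using V by (cases "i = j") simp_all
  have "(if P then \<epsilon> else 0) * x + (if Q then \<epsilon> else 0) * y =
      \<epsilon> * ((if P then x else 0) + (if Q then y else 0))" for P Q x y
    by (simp add: distrib_left)
  hence loops: "(if i = u \<and> j = v then \<epsilon> else 0) * ?f a + (if i = v \<and> j = u then \<epsilon> else 0) * ?f (- a) =
      \<epsilon> * loop_term u v (?f a) i j"
    unfolding loop_term_def pairing_minus power_int_minus .
  show ?thesis
    unfolding floquet_at_def distrib_right edge_sum diag loops by (cases "i = j") simp_all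
qed

text \<open>All choices for one component as a single tuple: lifts \<open>g\<close>, tree matrix
  \<open>A\<close>, an edge from \<open>u\<close> to \<open>v\<close> of nonzero shift
  \<open>a\<close> between the lifts, and its label \<epsilon>.\<close>

definition loop_data :: "'v set \<Rightarrow> ('v \<Rightarrow> int ^ 'd) \<times> ('v \<Rightarrow> 'v \<Rightarrow> complex) \<times> 'v \<times> 'v \<times> (int ^ 'd) \<times> complex \<Rightarrow> bool" where
  "loop_data C = (\<lambda>(g, A, u, v, a, \<epsilon>). symmetric_on C A \<and>
     (\<forall>i\<in>C. \<forall>j\<in>C. i \<noteq> j \<longrightarrow> A i j \<noteq> 0 \<longrightarrow> (act G i (g i), act G j (g j)) \<in> edges G) \<and>
     u \<in> C \<and> v \<in> C \<and> a \<noteq> 0 \<and> (act G u (g u), act G v (g v + a)) \<in> edges G \<and>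
     (\<forall>\<mu>. finite {s. s \<noteq> 0 \<and>
        singular_on C (shift_diag (\<lambda>i j. A i j + \<epsilon> * loop_term u v s i j) \<mu>)}))"

text \<open>In the tree gauge some edge has nonzero shift, since otherwise
  \<open>component_of_support_zero\<close> would produce a component of support 0.\<close>

lemma loop_data_exists:
  assumes W: "fundamental_domain G W" "finite W" and r: "r \<in> W"
    and none: "\<not> (\<exists>W U. fundamental_domain G W \<and> is_component G W U \<and> U \<noteq> {} \<and> has_support_zero G U)"
  shows "\<exists>d. loop_data (quotient_component W r) d"
proof -
  let ?C = "quotient_component W r"
  have fin: "finite ?C" using W(2) quotient_component_subset finite_subset by blast
  have verts: "?C \<subseteq> verts G"
    using W(1) quotient_component_subset[of W r] by (auto simp: fundamental_domain_def)
  obtain g A where gA: "symmetric_on ?C A" "full_eigenvectors ?C A"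
    "\<forall>i\<in>?C. \<forall>j\<in>?C. i \<noteq> j \<longrightarrow> A i j \<noteq> 0 \<longrightarrow> (act G i (g i), act G j (g j)) \<in> edges G"
    using full_eigenvectors_on_connected[OF fin quotient_component_self[OF r] verts
      quotient_component_connected] by metis
  have "\<exists>u\<in>?C. \<exists>v\<in>?C. \<exists>a. (act G u (g u), act G v (g v + a)) \<in> edges G \<and> a \<noteq> 0"
    using component_of_support_zero[OF W(1) quotient_component_subset, of r g]
      quotient_component_self[OF r] quotient_component_closed none by blast
  then obtain u v a where uva: "u \<in> ?C" "v \<in> ?C" "a \<noteq> 0"
    "(act G u (g u), act G v (g v + a)) \<in> edges G" by blast
  obtain \<epsilon> where eps: "\<forall>\<mu>. finite {s. s \<noteq> 0 \<and>
      singular_on ?C (shift_diag (\<lambda>i j. A i j + \<epsilon> * loop_term u v s i j) \<mu>)}"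
    using finite_singular_loop[OF fin gA(1,2) uva(1,2)] by blast
  have "loop_data ?C (g, A, u, v, a, \<epsilon>)"
    unfolding loop_data_def using gA(1,3) uva eps by simp
  thus ?thesis ..
qed

end

section \<open>A labeling and two points without a common eigenvalue\<close>

lemma finite_powi_preimage:
  assumes "b \<noteq> 0" "finite F"
  shows "finite {t :: complex. t powi b \<in> F}"
proof -
  have "finite {t :: complex. t powi b = s}" for s
  proof (cases "b > 0")
    case True
    hence "{t :: complex. t powi b = s} = {t. t ^ nat b = s}" by (auto simp: power_int_def)
    thus ?thesis using True finite_nth_roots[of "nat b" s] by simp
  next
    case False
    hence "{t :: complex. t powi b = s} = {t. t ^ nat (- b) = inverse s}"
      by (auto simp: power_int_def power_inverse)
    thus ?thesis using False assms(1) finite_nth_roots[of "nat (- b)" "inverse s"] by simp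
  qed
  moreover have "{t :: complex. t powi b \<in> F} = (\<Union>s\<in>F. {t. t powi b = s})" by auto
  ultimately show ?thesis using assms(2) by simp
qed

context periodic_graph
begin

text \<open>The terms for a and - a change places. This provides the reversal condition of
  \<open>labeling_exists\<close>.\<close>

lemma block_coeff_swap:
  assumes "A i j = A j i"
  shows "block_coeff A u v a \<epsilon> i j b = block_coeff A u v a \<epsilon> j i (- b)"
proof -
  have b: "- b = 0 \<longleftrightarrow> b = 0" "- b = a \<longleftrightarrow> b = - a" "- b = - a \<longleftrightarrow> b = a"
    using minus_equation_iff[of b a] by auto
  have ij: "j = i \<longleftrightarrow> i = j" "j = u \<and> i = v \<longleftrightarrow> i = v \<and> j = u" "j = v \<and> i = u \<longleftrightarrow> i = u \<and> j = v"
    by auto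
  show ?thesis
    unfolding block_coeff_def b ij assms by (simp only: add.commute)
qed

text \<open>The Floquet matrix splits into the blocks of the quotient components, and
  \<open>t\<close> is chosen so that no block has an eigenvalue in the finite spectrum of
  L(1).\<close>

lemma labeling_without_common_eigenvalue:
  assumes W: "fundamental_domain G W" and fin: "finite W"
    and none: "\<not> (\<exists>W U. fundamental_domain G W \<and> is_component G W U \<and> U \<noteq> {} \<and> has_support_zero G U)"
  shows "\<exists>l\<in>labelings G. \<exists>m t. t \<noteq> 0 \<and> \<not> (\<exists>\<mu>. singular_on W (shift_diag (floquet_at m 1 l) \<mu>) \<and>
    singular_on W (shift_diag (floquet_at m t l) \<mu>))"
proof -
  let ?comp = "quotient_component W"
  have verts: "i \<in> verts G" if "i \<in> W" for i using W that by (auto simp: fundamental_domain_def)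
  have comp_eq: "?comp j = ?comp r" if "j \<in> ?comp r" for j r
    using quotient_component_eq[OF _ that] verts by blast
  have sub: "?comp r \<subseteq> W" for r by (rule quotient_component_subset)
  have "\<forall>C\<in>?comp ` W. \<exists>d. loop_data C d"
    using loop_data_exists[OF W fin _ none] by blast
  \<comment> \<open>The choice is made per component and not per representative, so that all
    vertices of a component use the same tuple.\<close>
  then obtain D where D: "\<forall>C\<in>?comp ` W. loop_data C (D C)" using bchoice[of "?comp ` W" loop_data] by blast
  define gg where "gg C = fst (D C)" for C
  define A where "A C = fst (snd (D C))" for C
  define u where "u C = fst (snd (snd (D C)))" for C
  define v where "v C = fst (snd (snd (snd (D C))))" for C
  define a where "a C = fst (snd (snd (snd (snd (D C)))))" for C
  define e where "e C = snd (snd (snd (snd (snd (D C)))))" for C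
  have "D C = (gg C, A C, u C, v C, a C, e C)" for C
    by (simp add: gg_def A_def u_def v_def a_def e_def)
  hence data: "loop_data (?comp r) (gg (?comp r), A (?comp r), u (?comp r), v (?comp r), a (?comp r), e (?comp r))"
    if "r \<in> W" for r using D that by (metis imageI)
  define g where "g i = gg (?comp i) i" for i
  \<comment> \<open>Each component is labeled in its own gauge: the shift b of (i, j + b) becomes b
    + g i - g j.\<close>
  define k where "k i j b = (if i \<in> W \<and> j \<in> W \<and> ?comp i = ?comp j
    then block_coeff (A (?comp i)) (u (?comp i)) (v (?comp i)) (a (?comp i)) (e (?comp i)) i j (b + (g i - g j))
    else 0)" for i j b
  have "k i j b = k j i (- b)" for i j b
  proof (cases "i \<in> W \<and> j \<in> W \<and> ?comp i = ?comp j")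
    case True
    have "A (?comp i) i j = A (?comp i) j i"
      using data[of i] True quotient_component_self[of i W] quotient_component_self[of j W]
      by (auto simp: loop_data_def symmetric_on_def)
    moreover have "- b + (g j - g i) = - (b + (g i - g j))" by simp
    ultimately show ?thesis using True block_coeff_swap[of "A (?comp i)" i j] unfolding k_def by metis
  next
    case False
    thus ?thesis by (auto simp: k_def)
  qed
  then obtain l where l: "l \<in> labelings G" "\<forall>i\<in>W. fst l i = A (?comp i) i i"
    "\<forall>i\<in>W. \<forall>j\<in>W. \<forall>b. (i, act G j b) \<in> edges G \<longrightarrow> snd l (i, act G j b) = k i j b"
    using labeling_exists[OF W, of k "\<lambda>i. A (?comp i) i i"] by blast
  have block: "floquet_at m t l i j * t powi pairing m (g i - g j) =
      A C i j + e C * loop_term (u C) (v C) (t powi pairing m (a C)) i j"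
    if C: "C = ?comp r" "r \<in> W" and ij: "i \<in> C" "j \<in> C" and t: "t \<noteq> 0" for C r i j m t
  proof -
    have g: "g x = gg C x" "?comp x = C" if "x \<in> C" for x
      using that comp_eq C(1) by (auto simp: g_def)
    have CW: "C \<subseteq> W" using C sub by blast
    note d = data[OF C(2), folded C(1), unfolded loop_data_def prod.case]
    show ?thesis
    proof (rule floquet_block)
      show "i \<in> verts G" "j \<in> verts G" "u C \<in> verts G" "v C \<in> verts G"
        using ij d CW verts by blast+
      show "fst l i = A C i i" using l(2) ij(1) CW g(2) by auto
      show "snd l (i, act G j b) = block_coeff (A C) (u C) (v C) (a C) (e C) i j (b + (g i - g j))"
        if "(i, act G j b) \<in> edges G" for b
      proof -
        have "snd l (i, act G j b) = k i j b" using l(3) ij CW that by blast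
        thus ?thesis
          unfolding k_def g(2)[OF ij(1)] g(2)[OF ij(2)] using subsetD[OF CW ij(1)] subsetD[OF CW ij(2)] by simp
      qed
      show "(act G i (g i), act G j (g j)) \<in> edges G" if "i \<noteq> j" "A C i j \<noteq> 0"
        using d that ij g(1) by simp
      show "(act G (u C) (g (u C)), act G (v C) (g (v C) + a C)) \<in> edges G"
        using d g(1) by simp
    qed (rule t)
  qed
  have off_block: "floquet_at m t l i j = 0" if "r \<in> W" "i \<in> ?comp r" "j \<in> W" "j \<notin> ?comp r" for r i j m t
  proof -
    have "{b. (i, act G j b) \<in> edges G} = {}"
      using quotient_component_closed[OF that(2,3)] that(4) unfolding adjacent_def by blast
    thus ?thesis using that unfolding floquet_at_def by auto
  qed
  \<comment> \<open>With this \<open>m\<close>, z^a is a nonconstant power of t for the marked shift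
    a of every component.\<close>
  obtain m where m: "\<forall>b\<in>a ` ?comp ` W. pairing m b \<noteq> 0"
    using direction_exists[of "a ` ?comp ` W"] fin data unfolding loop_data_def by fastforce
  define B where "B C \<mu> = {s. s \<noteq> 0 \<and>
    singular_on C (shift_diag (\<lambda>i j. A C i j + e C * loop_term (u C) (v C) s i j) \<mu>)}" for C \<mu>
  define Sp where "Sp = {\<mu>. singular_on W (shift_diag (floquet_at m 1 l) \<mu>)}"
  have "finite Sp"
  proof -
    obtain es where es: "set es = W" "distinct es" using finite_distinct_list[OF fin] by blast
    have "char_poly (list_mat es (floquet_at m 1 l)) \<noteq> 0"
      using degree_monic_char_poly[OF list_mat_carrier] by (metis coeff_0 zero_neq_one)
    thus ?thesis
      unfolding Sp_def es(1)[symmetric] singular_shift_iff_char_poly[OF es(2)] by (rule poly_roots_finite)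
  qed
  moreover have "finite {t. t powi pairing m (a C) \<in> B C \<mu>}" if "C \<in> ?comp ` W" for C \<mu>
    using that m data unfolding B_def loop_data_def by (intro finite_powi_preimage) auto
  ultimately have "finite (insert 0 (\<Union>\<mu>\<in>Sp. \<Union>C\<in>?comp ` W. {t. t powi pairing m (a C) \<in> B C \<mu>}))"
    using fin by auto
  \<comment> \<open>Each eigenvalue of L(1) and each component exclude finitely many t; 0 is
    excluded to stay in the torus.\<close>
  then obtain t where "t \<notin> insert 0 (\<Union>\<mu>\<in>Sp. \<Union>C\<in>?comp ` W. {t. t powi pairing m (a C) \<in> B C \<mu>})"
    using ex_new_if_finite[OF infinite_UNIV_char_0] by blast
  hence t: "t \<noteq> 0" "\<And>\<mu> r. \<mu> \<in> Sp \<Longrightarrow> r \<in> W \<Longrightarrow> t powi pairing m (a (?comp r)) \<notin> B (?comp r) \<mu>" by auto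
  have "\<not> singular_on W (shift_diag (floquet_at m t l) \<mu>)" if "\<mu> \<in> Sp" for \<mu>
  proof
    assume "singular_on W (shift_diag (floquet_at m t l) \<mu>)"
    \<comment> \<open>The component of an index \<open>r\<close> with nonzero entry is used, so that
      the eigenvector restricted to it is nonzero.\<close>
    then obtain x r where x: "r \<in> W" "x r \<noteq> 0"
      "\<forall>i\<in>W. (\<Sum>j\<in>W. shift_diag (floquet_at m t l) \<mu> i j * x j) = 0"
      unfolding singular_on_def by blast
    define C where "C = ?comp r"
    define s where "s = t powi pairing m (a C)"
    define M where "M i j = A C i j + e C * loop_term (u C) (v C) s i j" for i j
    \<comment> \<open>The gauge of \<open>floquet_block\<close>, applied to the eigenvector.\<close>
    let ?y = "\<lambda>j. t powi pairing m (g j) * x j"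
    have "(\<Sum>j\<in>C. shift_diag M \<mu> i j * ?y j) = 0" if i: "i \<in> C" for i
    proof -
      have iW: "i \<in> W" using i sub C_def by blast
      have scale: "shift_diag M \<mu> i j * ?y j =
          t powi pairing m (g i) * (shift_diag (floquet_at m t l) \<mu> i j * x j)" if j: "j \<in> C" for j
      proof -
        have "M i j = floquet_at m t l i j * t powi pairing m (g i - g j)"
          using block[OF C_def x(1) i j t(1)] by (simp add: M_def s_def)
        moreover have "t powi pairing m (g i - g j) * t powi pairing m (g j) = t powi pairing m (g i)"
          using t(1) by (simp add: pairing_diff power_int_diff)
        ultimately have "M i j * ?y j = t powi pairing m (g i) * (floquet_at m t l i j * x j)"
          by (metis mult.assoc mult.commute)
        thus ?thesis by (auto simp: shift_diag_def algebra_simps)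
      qed
      have "(\<Sum>j\<in>C. shift_diag M \<mu> i j * ?y j) =
          t powi pairing m (g i) * (\<Sum>j\<in>C. shift_diag (floquet_at m t l) \<mu> i j * x j)"
        unfolding sum_distrib_left by (rule sum.cong[OF refl scale])
      also have "(\<Sum>j\<in>C. shift_diag (floquet_at m t l) \<mu> i j * x j) =
          (\<Sum>j\<in>W. shift_diag (floquet_at m t l) \<mu> i j * x j)"
      proof (rule sum.mono_neutral_left[OF fin])
        show "C \<subseteq> W" using sub C_def by blast
        show "\<forall>j\<in>W - C. shift_diag (floquet_at m t l) \<mu> i j * x j = 0"
          using off_block[OF x(1)] i unfolding C_def by (auto simp: shift_diag_def)
      qed
      finally show ?thesis using x(3) iW by simp
    qed
    moreover have "\<exists>i\<in>C. ?y i \<noteq> 0"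
      using x(1,2) t(1) quotient_component_self[OF x(1)] by (intro bexI[of _ r]) (auto simp: C_def)
    ultimately have "singular_on C (shift_diag M \<mu>)"
      unfolding singular_on_def by (intro exI[of _ ?y]) auto
    hence "s \<in> B C \<mu>" using t(1) by (simp add: B_def M_def[abs_def] s_def)
    thus False using t(2)[OF \<open>\<mu> \<in> Sp\<close> x(1)] by (simp add: s_def C_def)
  qed
  thus ?thesis using l(1) t(1) unfolding Sp_def by blast
qed

section \<open>A constant block gives a linear factor\<close>

lemma single_sum: "Poly_Mapping.single a (\<Sum>i\<in>S. f i) = (\<Sum>i\<in>S. Poly_Mapping.single a (f i))"
  by (induction S rule: infinite_finite_induct) (auto simp: single_add)

text \<open>From adj(A) A = det(A) I follows det(A) v = 0, and an invertible entry of v can be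
  cancelled. In the application this entry is a multiple of a monomial.\<close>

lemma det_eq_0_if_kernel:
  fixes A :: "'r :: comm_ring_1 mat"
  assumes A: "A \<in> carrier_mat n n" and v: "v \<in> carrier_vec n" "A *\<^sub>v v = 0\<^sub>v n"
    and k: "k < n" "vec_index v k * w = 1"
  shows "det A = 0"
proof -
  have "(det A \<cdot>\<^sub>m 1\<^sub>m n) *\<^sub>v v = adj_mat A *\<^sub>v (A *\<^sub>v v)"
    unfolding adj_mat(3)[OF A, symmetric] using adj_mat(1)[OF A] A v(1) by simp
  also have "\<dots> = 0\<^sub>v n" unfolding v(2) using adj_mat(1)[OF A] by (intro eq_vecI) auto
  finally have "((det A \<cdot>\<^sub>m 1\<^sub>m n) *\<^sub>v v) $ k = 0" using k(1) by simp
  moreover have "((det A \<cdot>\<^sub>m 1\<^sub>m n) *\<^sub>v v) $ k = det A * vec_index v k"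
  proof -
    have "((det A \<cdot>\<^sub>m 1\<^sub>m n) *\<^sub>v v) $ k = (\<Sum>i = 0..<n. det A * (if i = k then 1 else 0) * vec_index v i)"
      using v(1) k(1) by (simp add: scalar_prod_def)
    also have "\<dots> = (\<Sum>i = 0..<n. if i = k then det A * vec_index v k else 0)"
      by (rule sum.cong) auto
    finally show ?thesis using k(1) by simp
  qed
  ultimately have "det A * (vec_index v k * w) = 0" by (simp flip: mult.assoc)
  thus ?thesis using k(2) by simp
qed

lemma component_imp_linear_factor:
  assumes ws: "distinct ws" "fundamental_domain G (set ws)"
    and W: "fundamental_domain G W" and U: "is_component G W U" "U \<noteq> {}" "has_support_zero G U"
    and l: "l \<in> labelings G"
  shows "has_linear_factor (dispersion_polynomial G ws l)"
proof -
  let ?n = "length ws"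
  obtain g where g: "\<And>i. i \<in> set ws \<Longrightarrow> act G i (g i) \<in> W"
    "\<And>u. u \<in> W \<Longrightarrow> \<exists>i\<in>set ws. act G i (g i) = u"
    using fundamental_domain_transport[OF ws(2) W] by blast
  have verts: "i \<in> verts G" if "i \<in> set ws" for i using ws(2) that by (auto simp: fundamental_domain_def)
  define C where "C = {i \<in> set ws. act G i (g i) \<in> U}"
  have CW: "C \<subseteq> set ws" by (auto simp: C_def)
  have "C \<noteq> {}" using U(1,2) g(2) unfolding C_def is_component_def by blast
  \<comment> \<open>The block of \<open>U\<close> in the gauge \<open>g\<close>. It is constant in
    z: support 0 leaves one shift per entry, and non-edges have label 0.\<close>
  define M where "M i j = (if i = j then fst l i else 0) + snd l (act G i (g i), act G j (g j))" for i j
  obtain \<mu> where "singular_on C (shift_diag M \<mu>)"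
    using eigenvalue_exists[of C M] \<open>C \<noteq> {}\<close> finite_subset[OF CW] by blast
  then obtain x r where x: "r \<in> C" "x r \<noteq> 0" "\<forall>i\<in>C. (\<Sum>j\<in>C. shift_diag M \<mu> i j * x j) = 0"
    unfolding singular_on_def by blast
  let ?z = "\<lambda>c. Poly_Mapping.single (0 :: int ^ 'd) (c :: complex)"
  define L where "L i j = (if i = j then ?z (fst l i) else 0) +
      (\<Sum>a\<in>{a. (i, act G j a) \<in> edges G}. Poly_Mapping.single a (snd l (i, act G j a))) -
      (if i = j then ?z \<mu> else 0)" for i j
  \<comment> \<open>Undoing the gauge multiplies the eigenvector by the monomials z^(- g i); it is
    extended by 0 outside \<open>C\<close>.\<close>
  define y where "y i = (if i \<in> C then Poly_Mapping.single (- g i) (x i) else 0)" for i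
  have in_C: "L i j * y j = Poly_Mapping.single (- g i) (shift_diag M \<mu> i j * x j)"
    if ij: "i \<in> C" "j \<in> C" for i j
  proof -
    have v: "i \<in> verts G" "j \<in> verts G" using ij CW verts by auto
    let ?e = "(act G i (g i), act G j (g j))"
    \<comment> \<open>Support 0 allows a single shift between \<open>i\<close> and
      \<open>j\<close>.\<close>
    have only: "a = g j - g i" if "(i, act G j a) \<in> edges G" for a
    proof -
      have "(act G i (g i), act G j (a + g i)) \<in> edges G" using that edge_act_iff[OF v] by simp
      moreover have "act G j (a + g i) = act G (act G j (g j)) (a + g i - g j)"
        using act_add[OF v(2), of "g j" "a + g i - g j"] by simp
      ultimately have "a + g i - g j \<in> support G U"
        unfolding support_def using ij by (auto simp: C_def)
      hence "a + g i - g j = 0" using U(3) unfolding has_support_zero_def by auto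
      thus ?thesis by (simp add: algebra_simps)
    qed
    have "(\<Sum>a\<in>{a. (i, act G j a) \<in> edges G}. Poly_Mapping.single a (snd l (i, act G j a))) =
        Poly_Mapping.single (g j - g i) (snd l ?e)"
    proof (cases "(i, act G j (g j - g i)) \<in> edges G")
      case True
      hence "{a. (i, act G j a) \<in> edges G} = {g j - g i}" using only True by blast
      moreover have "snd l (act G i (g i), act G (act G j (g j - g i)) (g i)) = snd l (i, act G j (g j - g i))"
        using l True unfolding labelings_def by auto
      hence "snd l ?e = snd l (i, act G j (g j - g i))"
        using act_add[OF v(2), of "g j - g i" "g i"] by simp
      ultimately show ?thesis by simp
    next
      case False
      hence "{a. (i, act G j a) \<in> edges G} = {}" using only by blast
      moreover have "?e \<notin> edges G" using False edge_act_iff[OF v] by simp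
      hence "snd l ?e = 0" using l unfolding labelings_def by auto
      ultimately show ?thesis by (simp only: sum.empty single_zero)
    qed
    thus ?thesis
      using ij by (auto simp: L_def y_def M_def shift_diag_def mult_single distrib_right left_diff_distrib
          single_add single_diff algebra_simps)
  qed
  \<comment> \<open>No edge leaves the component, so rows outside \<open>C\<close> are 0 on the
    columns of \<open>C\<close>.\<close>
  have off_C: "L i j = 0" if ij: "i \<in> set ws" "i \<notin> C" "j \<in> C" for i j
  proof -
    have v: "i \<in> verts G" "j \<in> verts G" using ij CW verts by auto
    have "(i, act G j a) \<notin> edges G" for a
    proof
      assume "(i, act G j a) \<in> edges G"
      hence "(j, act G i (- a)) \<in> edges G" using edge_flip[OF v] by simp
      hence "(act G j (g j), act G i (g j - a)) \<in> edges G" using edge_act_iff[OF v(2,1)] by simp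
      moreover have "act G i (g j - a) = act G (act G i (g i)) (g j - a - g i)"
        using act_add[OF v(1), of "g i" "g j - a - g i"] by simp
      ultimately show False
        using U(1) ij g(1)[OF ij(1)] unfolding is_component_def C_def by auto
    qed
    thus ?thesis using ij unfolding L_def by auto
  qed
  have kernel: "(\<Sum>j\<in>set ws. L i j * y j) = 0" if "i \<in> set ws" for i
  proof -
    have "(\<Sum>j\<in>set ws. L i j * y j) = (\<Sum>j\<in>C. L i j * y j)"
      by (rule sum.mono_neutral_right) (use CW in \<open>auto simp: y_def\<close>)
    also have "\<dots> = 0"
    proof (cases "i \<in> C")
      case True
      hence "(\<Sum>j\<in>C. L i j * y j) = Poly_Mapping.single (- g i) (\<Sum>j\<in>C. shift_diag M \<mu> i j * x j)"
        using in_C by (simp add: single_sum)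
      thus ?thesis using x(3) True by simp
    qed (use off_C that in auto)
    finally show ?thesis .
  qed
  obtain k where k: "k < ?n" "ws ! k = r" using x(1) CW by (metis in_set_conv_nth subsetD)
  have "det (list_mat ws L) = 0"
  proof (rule det_eq_0_if_kernel[OF list_mat_carrier])
    let ?v = "vec ?n (\<lambda>k. y (ws ! k))"
    show "?v \<in> carrier_vec ?n" by simp
    show "list_mat ws L *\<^sub>v ?v = 0\<^sub>v ?n"
    proof (rule eq_vecI)
      fix k assume k: "k < dim_vec (0\<^sub>v ?n :: 'd laurent vec)"
      hence "(list_mat ws L *\<^sub>v ?v) $ k = (\<Sum>j = 0..<?n. L (ws ! k) (ws ! j) * y (ws ! j))"
        by (simp add: list_mat_def scalar_prod_def)
      also have "\<dots> = (\<Sum>j\<in>set ws. L (ws ! k) j * y j)" by (rule sum_list_index[OF ws(1)])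
      finally show "(list_mat ws L *\<^sub>v ?v) $ k = 0\<^sub>v ?n $ k" using kernel[of "ws ! k"] k by simp
    qed (simp add: list_mat_def)
    show "k < ?n" by (rule k(1))
    \<comment> \<open>Entry \<open>r\<close> is a nonzero multiple of a monomial, hence a
      unit.\<close>
    show "?v $ k * Poly_Mapping.single (g r) (inverse (x r)) = 1"
      using k x(1,2) by (simp add: y_def mult_single)
  qed
  moreover have "list_mat ws L = map_mat (\<lambda>p. poly p (?z \<mu>))
      (map_mat (\<lambda>c. [:c:]) (floquet_matrix G ws l) - [:0, 1:] \<cdot>\<^sub>m 1\<^sub>m ?n)"
    by (rule eq_matI)
      (auto simp: list_mat_def floquet_matrix_def L_def nth_eq_iff_index_eq[OF ws(1)])
  ultimately have "poly (dispersion_polynomial G ws l) (?z \<mu>) = 0"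
    unfolding dispersion_polynomial_def using comm_ring_hom.hom_det[OF eval_poly_hom] by metis
  thus ?thesis unfolding has_linear_factor_def poly_eq_0_iff_dvd by blast
qed

end

section \<open>The equivalence for a generic labeling\<close>

theorem theorem3p13:
  fixes G :: "('v, 'd::finite) zgraph" and ws :: "'v list"
  assumes "periodic_graph G"
    and "distinct ws" and "fundamental_domain G (set ws)"
  shows "for_generic_labeling G (\<lambda>l.
     has_linear_factor (dispersion_polynomial G ws l) \<longleftrightarrow>
     (\<exists>W U. fundamental_domain G W \<and> is_component G W U \<and> U \<noteq> {} \<and> has_support_zero G U))"
proof -
  interpret periodic_graph G by (rule assms(1))
  show ?thesis
  \<comment> \<open>The condition on components does not involve the labeling. If it holds, every
    labeling gives a linear factor; otherwise a nonempty open set of labelings gives none.\<close>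
  proof (cases "\<exists>W U. fundamental_domain G W \<and> is_component G W U \<and> U \<noteq> {} \<and> has_support_zero G U")
    case True
    have "(\<lambda>_. 0, \<lambda>_. 0) \<in> labelings G" by (auto simp: labelings_def)
    \<comment> \<open>The complement is empty, the zero set of the constant 1.\<close>
    moreover have "zariski_open G (labelings G)"
      unfolding zariski_open_def zariski_closed_def
      by (intro conjI exI[of _ "{\<lambda>_. 1}"]) (auto intro: polynomial_functions.const)
    moreover have "has_linear_factor (dispersion_polynomial G ws l)" if "l \<in> labelings G" for l
      using True component_imp_linear_factor[OF assms(2,3) _ _ _ _ that] by blast
    ultimately show ?thesis unfolding for_generic_labeling_def using True by blast
  next
    case False
    let ?n = "length ws"
    obtain l0 m t where l0: "l0 \<in> labelings G" "t \<noteq> 0"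
      "\<not> (\<exists>\<mu>. singular_on (set ws) (shift_diag (floquet_at m 1 l0) \<mu>) \<and>
        singular_on (set ws) (shift_diag (floquet_at m t l0) \<mu>))"
      using labeling_without_common_eigenvalue[OF assms(3) _ False] by blast
    let ?\<chi> = "\<lambda>t l. char_poly (list_mat ws (floquet_at m t l))"
    \<comment> \<open>The Sylvester determinant of the characteristic polynomials at two fixed
      points: polynomial in the labels, and 0 exactly when the two matrices share an
      eigenvalue.\<close>
    define R where "R l = det (list_mat [0..<2 * ?n] (sylvester_matrix ?n (?\<chi> 1 l) (?\<chi> t l)))" for l
    have n: "?n > 0"
      using assms(3) verts_nonempty unfolding fundamental_domain_def by (cases ws) auto
    have deg: "degree (?\<chi> t l) = ?n" for t l
      using degree_monic_char_poly[OF list_mat_carrier] by blast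
    have R: "R l = 0 \<longleftrightarrow> (\<exists>\<mu>. singular_on (set ws) (shift_diag (floquet_at m 1 l) \<mu>) \<and>
        singular_on (set ws) (shift_diag (floquet_at m t l) \<mu>))" for l
      unfolding R_def singular_on_iff_det[OF distinct_upt, symmetric]
        singular_shift_iff_char_poly[OF assms(2)]
      using sylvester_matrix_singular_iff[OF deg deg n] by (simp add: lessThan_atLeast0)
    have coeff: "(\<lambda>l. coeff (?\<chi> t l) k) \<in> polynomial_functions G" for t k
    proof (rule polynomial_functions_coeff_char_poly[OF list_mat_carrier])
      fix i j assume "i < ?n" "j < ?n"
      moreover from this have "ws ! i \<in> verts G" using assms(3) by (auto simp: fundamental_domain_def)
      ultimately show "(\<lambda>l. list_mat ws (floquet_at m t l) $$ (i, j)) \<in> polynomial_functions G"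
        by (simp add: list_mat_def polynomial_functions_floquet_at)
    qed
    have "R \<in> polynomial_functions G"
      unfolding R_def[abs_def]
    proof (rule polynomial_functions_det)
      fix i j assume "i < length [0..<2 * ?n]" "j < length [0..<2 * ?n]"
      hence "list_mat [0..<2 * ?n] M $$ (i, j) = M i j" for M :: "nat \<Rightarrow> nat \<Rightarrow> complex"
        by (simp add: list_mat_def)
      thus "(\<lambda>l. list_mat [0..<2 * ?n] (sylvester_matrix ?n (?\<chi> 1 l) (?\<chi> t l)) $$ (i, j))
          \<in> polynomial_functions G"
        by (cases "j < ?n"; cases "j \<le> i"; cases "j - ?n \<le> i")
          (simp_all add: sylvester_matrix_def coeff polynomial_functions.const)
    qed (rule list_mat_carrier)
    hence "zariski_open G {l \<in> labelings G. R l \<noteq> 0}"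
      unfolding zariski_open_def zariski_closed_def by (intro conjI exI[of _ "{R}"]) auto
    moreover have "\<not> has_linear_factor (dispersion_polynomial G ws l)" if "R l \<noteq> 0" for l
    proof
      assume "has_linear_factor (dispersion_polynomial G ws l)"
      then obtain c where c: "\<And>m t. t \<noteq> 0 \<Longrightarrow> singular_on (set ws) (shift_diag (floquet_at m t l) c)"
        using linear_factor_imp_common_eigenvalue[OF assms(2)] by blast
      have "R l = 0" unfolding R using c[of 1] c[OF l0(2)] by auto
      thus False using that by simp
    qed
    moreover have "R l0 \<noteq> 0" using R l0(3) by blast
    hence "{l \<in> labelings G. R l \<noteq> 0} \<noteq> {}" using l0(1) by blast
    ultimately show ?thesis
      unfolding for_generic_labeling_def using False
      by (intro exI[of _ "{l \<in> labelings G. R l \<noteq> 0}"] conjI ballI) blast+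
  qed
qed

end
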